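(* Let $\omega$ be a modulus of continuity such that $\omega_\sharp$ is finite valued. There exist unitary operators $U$, $V$ on a Hilbert space and a real-valued function $h\in\Lambda_{\omega_{\sharp}}(\mathbb{T})$ such that $$\operatorname{rank}(U-V)=1\qquad\text{and}\qquad s_m\big(h(U)-h(V)\big)\ge\omega\big((1+m)^{-1}\big)\quad\text{for all } m\ge0.$$
   Context: A modulus of continuity is a nondecreasing continuous function $\omega:[0,\infty)\to[0,\infty)$ with $\omega(0)=0$, $\omega(x)>0$ for $x>0$, and $\omega(x+y)\le\omega(x)+\omega(y)$ for all $x,y\ge 0$. $\omega_{\sharp}(x):=x\int_x^\infty\frac{\omega(t)}{t^2}\,dt+\int_0^x\frac{\omega(t)}{t}\,dt$ for $x>0$. $\mathbb{T}$ is the unit circle in $\mathbb{C}$. $\Lambda_{\omega_\sharp}(\mathbb{T})$ is the space of functions $h:\mathbb{T}\to\mathbb{C}$ with $\sup_{\zeta\ne\eta}\frac{|h(\zeta)-h(\eta)|}{\omega_\sharp(|\zeta-\eta|)}<\infty$. For a bounded operator $T$ on a Hilbert space, the singular values are $s_m(T)=\inf\{\Vert T-R\Vert:\operatorname{rank}R\le m\}$, $m\ge0$. $h(U)$, $h(V)$ are given by the functional calculus for unitary operators. *)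

theory Defs
  imports
    "HOL-Analysis.Analysis"
    "HOL-Library.Function_Algebras"
    "HOL-Library.Extended_Nat"
begin

section \<open>Moduli of continuity\<close>

definition modulus_of_continuity :: "(real \<Rightarrow> real) \<Rightarrow> bool" where
  "modulus_of_continuity \<omega> \<longleftrightarrow>
     mono_on {0..} \<omega> \<and> continuous_on {0..} \<omega> \<and> \<omega> 0 = 0 \<and> (\<forall>x>0. \<omega> x > 0) \<and>
     (\<forall>x\<ge>0. \<forall>y\<ge>0. \<omega> (x + y) \<le> \<omega> x + \<omega> y)"

text \<open>The integrands are nonnegative, so the integrals are taken with values in
  \<open>[0, \<infinity>]\<close>; this makes the finiteness of \<open>\<omega>\<^sub>\<sharp>\<close> a meaningful condition.\<close>

definition omega_sharp :: "(real \<Rightarrow> real) \<Rightarrow> real \<Rightarrow> ennreal" where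
  "omega_sharp \<omega> x =
     ennreal x * (\<integral>\<^sup>+t\<in>{x..}. ennreal (\<omega> t / t\<^sup>2) \<partial>lborel) +
     (\<integral>\<^sup>+t\<in>{0<..x}. ennreal (\<omega> t / t) \<partial>lborel)"

definition finite_valued :: "(real \<Rightarrow> ennreal) \<Rightarrow> bool" where
  "finite_valued g \<longleftrightarrow> (\<forall>x>0. g x < \<infinity>)"

text \<open>The unit circle is \<^term>\<open>sphere (0::complex) 1\<close>. Functions on it are represented by
  functions on \<^typ>\<open>complex\<close>, whose values off the circle are irrelevant.\<close>

definition Lambda_space :: "(real \<Rightarrow> real) \<Rightarrow> (complex \<Rightarrow> complex) set" where
  "Lambda_space w =
     {h. bdd_above {cmod (h \<zeta> - h \<eta>) / w (cmod (\<zeta> - \<eta>)) |\<zeta> \<eta>.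
           \<zeta> \<in> sphere 0 1 \<and> \<eta> \<in> sphere 0 1 \<and> \<zeta> \<noteq> \<eta>}}"


section \<open>Complex Hilbert spaces\<close>

text \<open>The vectors form a linear subspace \<open>Space\<close> of an ambient complex vector space, whose
  addition is that of the type \<^typ>\<open>'v\<close>. The inner product and the topology live on \<open>Space\<close>
  only. HOL cannot quantify over types, but as \<open>Space\<close>, \<open>scl\<close> and \<open>ip\<close> are arbitrary,
  already \<^typ>\<open>int \<Rightarrow> complex\<close> as ambient type accommodates a copy of every separable Hilbert
  space.\<close>

record 'v inner_space =
  Space :: "'v set"
  scl :: "complex \<Rightarrow> 'v \<Rightarrow> 'v"
  ip :: "'v \<Rightarrow> 'v \<Rightarrow> complex"

definition hnorm :: "('v::ab_group_add) inner_space \<Rightarrow> 'v \<Rightarrow> real" where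
  "hnorm H x = sqrt (Re (ip H x x))"

locale hilbert_space = vector_space "scl H" for H :: "('v::ab_group_add) inner_space" +
  assumes subspace_Space: "subspace (Space H)"
    and ip_add_left: "\<lbrakk>x \<in> Space H; y \<in> Space H; z \<in> Space H\<rbrakk> \<Longrightarrow> ip H (x + y) z = ip H x z + ip H y z"
    and ip_scl_left: "\<lbrakk>x \<in> Space H; y \<in> Space H\<rbrakk> \<Longrightarrow> ip H (scl H c x) y = c * ip H x y"
    and ip_commute: "\<lbrakk>x \<in> Space H; y \<in> Space H\<rbrakk> \<Longrightarrow> ip H x y = cnj (ip H y x)"
    and ip_nonneg: "x \<in> Space H \<Longrightarrow> 0 \<le> Re (ip H x x)"
    and ip_definite: "\<lbrakk>x \<in> Space H; ip H x x = 0\<rbrakk> \<Longrightarrow> x = 0"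
    and complete: "\<lbrakk>\<And>n::nat. X n \<in> Space H;
        \<And>e. e > 0 \<Longrightarrow> \<exists>N. \<forall>m\<ge>N. \<forall>n\<ge>N. hnorm H (X m - X n) < e\<rbrakk>
      \<Longrightarrow> \<exists>x\<in>Space H. (\<lambda>n. hnorm H (X n - x)) \<longlonglongrightarrow> 0"


section \<open>Bounded operators\<close>

text \<open>Operators are extensional functions on \<^term>\<open>Space H\<close> (undefined elsewhere), so that
  equality of functions is equality of operators.\<close>

definition bounded_ops :: "('v::ab_group_add) inner_space \<Rightarrow> ('v \<Rightarrow> 'v) set" where
  "bounded_ops H =
     {T \<in> Space H \<rightarrow>\<^sub>E Space H.
        (\<forall>x\<in>Space H. \<forall>y\<in>Space H. T (x + y) = T x + T y) \<and>
        (\<forall>c. \<forall>x\<in>Space H. T (scl H c x) = scl H c (T x)) \<and>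
        (\<exists>K. \<forall>x\<in>Space H. hnorm H (T x) \<le> K * hnorm H x)}"

definition op_id :: "('v::ab_group_add) inner_space \<Rightarrow> 'v \<Rightarrow> 'v" where
  "op_id H = (\<lambda>x\<in>Space H. x)"

definition op_add :: "('v::ab_group_add) inner_space \<Rightarrow> ('v \<Rightarrow> 'v) \<Rightarrow> ('v \<Rightarrow> 'v) \<Rightarrow> 'v \<Rightarrow> 'v" where
  "op_add H S T = (\<lambda>x\<in>Space H. S x + T x)"

definition op_diff :: "('v::ab_group_add) inner_space \<Rightarrow> ('v \<Rightarrow> 'v) \<Rightarrow> ('v \<Rightarrow> 'v) \<Rightarrow> 'v \<Rightarrow> 'v" where
  "op_diff H S T = (\<lambda>x\<in>Space H. S x - T x)"

definition op_scl :: "('v::ab_group_add) inner_space \<Rightarrow> complex \<Rightarrow> ('v \<Rightarrow> 'v) \<Rightarrow> 'v \<Rightarrow> 'v" where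
  "op_scl H c T = (\<lambda>x\<in>Space H. scl H c (T x))"

definition op_norm :: "('v::ab_group_add) inner_space \<Rightarrow> ('v \<Rightarrow> 'v) \<Rightarrow> real" where
  "op_norm H T = Sup {hnorm H (T x) |x. x \<in> Space H \<and> hnorm H x \<le> 1}"

definition is_adjoint :: "('v::ab_group_add) inner_space \<Rightarrow> ('v \<Rightarrow> 'v) \<Rightarrow> ('v \<Rightarrow> 'v) \<Rightarrow> bool" where
  "is_adjoint H T S \<longleftrightarrow> (\<forall>x\<in>Space H. \<forall>y\<in>Space H. ip H (T x) y = ip H x (S y))"

definition unitary :: "('v::ab_group_add) inner_space \<Rightarrow> ('v \<Rightarrow> 'v) \<Rightarrow> bool" where
  "unitary H U \<longleftrightarrow> U \<in> bounded_ops H \<and>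
     (\<exists>S\<in>bounded_ops H. is_adjoint H U S \<and>
        compose (Space H) S U = op_id H \<and> compose (Space H) U S = op_id H)"

text \<open>The library's \<open>dim\<close> is \<open>0\<close> on infinite-dimensional subspaces, hence the case
  distinction.\<close>

definition op_rank :: "('v::ab_group_add) inner_space \<Rightarrow> ('v \<Rightarrow> 'v) \<Rightarrow> enat" where
  "op_rank H T =
     (if \<exists>B. finite B \<and> T ` Space H \<subseteq> module.span (scl H) B
      then enat (vector_space.dim (scl H) (T ` Space H)) else \<infinity>)"

definition singular_value :: "('v::ab_group_add) inner_space \<Rightarrow> ('v \<Rightarrow> 'v) \<Rightarrow> nat \<Rightarrow> real" where
  "singular_value H T m =
     Inf {op_norm H (op_diff H T R) |R. R \<in> bounded_ops H \<and> op_rank H R \<le> enat m}"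


section \<open>Functional calculus for unitary operators\<close>

text \<open>The spectrum of a unitary operator \<open>U\<close> lies on the unit circle. Its (continuous) functional
  calculus is the unital *-homomorphism from the continuous functions on the circle to the bounded
  operators that maps the identity function to \<open>U\<close>.\<close>

definition is_functional_calculus ::
    "('v::ab_group_add) inner_space \<Rightarrow> ('v \<Rightarrow> 'v) \<Rightarrow> ((complex \<Rightarrow> complex) \<Rightarrow> 'v \<Rightarrow> 'v) \<Rightarrow> bool" where
  "is_functional_calculus H U \<Phi> \<longleftrightarrow>
     (\<forall>f. continuous_on (sphere 0 1) f \<longrightarrow>
        \<Phi> f \<in> bounded_ops H \<and>
        (\<forall>c. \<Phi> (\<lambda>z. c * f z) = op_scl H c (\<Phi> f)) \<and>
        is_adjoint H (\<Phi> f) (\<Phi> (\<lambda>z. cnj (f z)))) \<and>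
     (\<forall>f g. continuous_on (sphere 0 1) f \<longrightarrow> continuous_on (sphere 0 1) g \<longrightarrow>
        \<Phi> (\<lambda>z. f z + g z) = op_add H (\<Phi> f) (\<Phi> g) \<and>
        \<Phi> (\<lambda>z. f z * g z) = compose (Space H) (\<Phi> f) (\<Phi> g) \<and>
        ((\<forall>z\<in>sphere 0 1. f z = g z) \<longrightarrow> \<Phi> f = \<Phi> g)) \<and>
     \<Phi> (\<lambda>z. 1) = op_id H \<and>
     \<Phi> (\<lambda>z. z) = U"

text \<open>Meaningful for \<open>U\<close> unitary and \<open>h\<close> continuous on the circle. The elements of
  \<open>\<Lambda>\<^bsub>\<omega>\<^sub>\<sharp>\<^esub>\<close> are continuous, since a finite \<open>\<omega>\<^sub>\<sharp>\<close> tends to \<open>0\<close> at \<open>0\<close>.\<close>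

definition fun_calc ::
    "('v::ab_group_add) inner_space \<Rightarrow> (complex \<Rightarrow> complex) \<Rightarrow> ('v \<Rightarrow> 'v) \<Rightarrow> 'v \<Rightarrow> 'v" where
  "fun_calc H h U = (THE A. \<exists>\<Phi>. is_functional_calculus H U \<Phi> \<and> A = \<Phi> h)"

end

theory Submission
  imports Defs "HOL-Complex_Analysis.Cauchy_Integral_Formula"
begin

text \<open>On \<open>\<ell>\<^sup>2(\<int>)\<close> let \<open>U\<close> be the bilateral shift, let \<open>J\<close> be the diagonal operator with entries
  \<open>1\<close> at the indices \<open>i \<ge> 0\<close> and \<open>-1\<close> at the indices \<open>i < 0\<close>, and let \<open>V = J U J\<close>. Then \<open>U - V\<close> has
  rank one and \<open>h(V) = J h(U) J\<close>, so \<open>h(U) - h(V)\<close> is twice the off-diagonal part of the Laurent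
  operator \<open>h(U)\<close>, a pair of Hankel operators. Take the lacunary symbol
  \<open>h(z) = 4 \<Sum>\<^sub>k \<omega>(2\<^sup>-\<^sup>k) Re z\<^bsup>2^k\<^esup>\<close>. The block of the Hankel operator with rows
  \<open>2^n \<le> i < 2^(n+1)\<close> and columns \<open>-2^n \<le> j < 0\<close> contains the single nonzero diagonal
  \<open>i - j = 2^(n+1)\<close>, so it is a multiple of an isometry on a space of dimension \<open>2^n\<close>, whence
  \<open>s\<^sub>m \<ge> 4 \<omega>(2^(-n-1))\<close> for \<open>m < 2^n\<close>. On the other hand
  \<open>\<bar>h(\<zeta>) - h(\<eta>)\<bar> \<le> 8 \<Sum>\<^sub>k \<omega>(2\<^sup>-\<^sup>k) min 1 (2\<^sup>k \<bar>\<zeta> - \<eta>\<bar>)\<close>, which is a dyadic Riemann sum for \<open>\<omega>\<^sub>\<sharp>\<close>.\<close>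

text \<open>Most of the work lies in \<open>fun_calc\<close>, a definite description over all unital
  *-homomorphisms, none of which is assumed continuous. Its value rests on an elementary von Neumann
  inequality for polynomials in \<open>U\<close> and its adjoint, on the closure of these
  polynomials under simultaneous uniform and operator approximation, and on the automatic
  contractivity of *-homomorphisms, which forces every functional calculus into that closure. The
  same closure explains \<open>h(V) = J h(U) J\<close>: conjugation turns approximants of
  \<open>h(U)\<close> into approximants of \<open>h(V)\<close> with the same symbols.

  The constant 4 in \<open>h\<close> is dictated by the singular values. To beat rank
  \<open>m\<close> the block needs dimension \<open>2^n > m\<close>; this can be had with
  \<open>2^n\<close> at most \<open>2 (m + 1)\<close>, so \<open>2^(-n-1)\<close> is at least a
  quarter of \<open>1 / (m + 1)\<close>, and subadditivity turns the quarter into a factor 4. It is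
  recovered exactly: \<open>4 Re z = 2 (z + cnj z)\<close> gives each diagonal a factor 2, and the
  difference with \<open>V\<close> doubles it.\<close>

section \<open>Hilbert space geometry and bounded operators\<close>

context hilbert_space
begin

lemma zero_Space [simp]: "0 \<in> Space H"
  using subspace_Space by (rule subspace_0)

lemma add_Space [simp]: "x \<in> Space H \<Longrightarrow> y \<in> Space H \<Longrightarrow> x + y \<in> Space H"
  using subspace_Space by (rule subspace_add)

lemma scl_Space [simp]: "x \<in> Space H \<Longrightarrow> scl H c x \<in> Space H"
  using subspace_Space by (rule subspace_scale)

lemma diff_Space [simp]: "x \<in> Space H \<Longrightarrow> y \<in> Space H \<Longrightarrow> x - y \<in> Space H"
  using subspace_Space by (rule subspace_diff)

lemma sum_Space: "(\<And>i. i \<in> A \<Longrightarrow> f i \<in> Space H) \<Longrightarrow> sum f A \<in> Space H"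
  using subspace_Space by (rule subspace_sum)

lemma ip_add_right:
  "\<lbrakk>x \<in> Space H; y \<in> Space H; z \<in> Space H\<rbrakk> \<Longrightarrow> ip H x (y + z) = ip H x y + ip H x z"
  by (metis add_Space complex_cnj_add ip_add_left ip_commute)

lemma ip_scl_right:
  "\<lbrakk>x \<in> Space H; y \<in> Space H\<rbrakk> \<Longrightarrow> ip H x (scl H c y) = cnj c * ip H x y"
  by (metis scl_Space complex_cnj_mult ip_scl_left ip_commute)

lemma ip_diff_left:
  assumes "x \<in> Space H" "y \<in> Space H" "z \<in> Space H"
  shows "ip H (x - y) z = ip H x z - ip H y z"
  using ip_add_left[of "x - y" y z] assms by simp

lemma ip_diff_right:
  assumes "x \<in> Space H" "y \<in> Space H" "z \<in> Space H"
  shows "ip H x (y - z) = ip H x y - ip H x z"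
  using ip_add_right[of x "y - z" z] assms by simp

lemma ip_zero_left [simp]: "x \<in> Space H \<Longrightarrow> ip H 0 x = 0"
  using ip_diff_left[of x x x] by simp

lemma ip_zero_right [simp]: "x \<in> Space H \<Longrightarrow> ip H x 0 = 0"
  using ip_diff_right[of x x x] by simp

lemma ip_eq_hnorm: "x \<in> Space H \<Longrightarrow> ip H x x = complex_of_real ((hnorm H x)\<^sup>2)"
  using ip_commute[of x x] ip_nonneg[of x]
  by (simp add: hnorm_def complex_eq_iff)

lemma hnorm_sq: "x \<in> Space H \<Longrightarrow> (hnorm H x)\<^sup>2 = Re (ip H x x)"
  by (simp add: ip_eq_hnorm)

lemma hnorm_nonneg [simp]: "x \<in> Space H \<Longrightarrow> 0 \<le> hnorm H x"
  by (simp add: hnorm_def ip_nonneg)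

lemma hnorm_zero [simp]: "hnorm H 0 = 0"
  by (simp add: hnorm_def)

lemma hnorm_eq_0: "x \<in> Space H \<Longrightarrow> hnorm H x = 0 \<longleftrightarrow> x = 0"
  using ip_definite[of x] ip_eq_hnorm[of x] by auto

lemma hnorm_scl: 
  assumes "x \<in> Space H"
  shows "hnorm H (scl H c x) = cmod c * hnorm H x"
proof -
  have "ip H (scl H c x) (scl H c x) = (c * cnj c) * ip H x x"
    using assms by (simp add: ip_scl_left ip_scl_right)
  also have "\<dots> = complex_of_real ((cmod c)\<^sup>2 * (hnorm H x)\<^sup>2)"
    by (simp only: complex_norm_square[symmetric] ip_eq_hnorm[OF assms] of_real_mult)
  finally have "(hnorm H (scl H c x))\<^sup>2 = (cmod c * hnorm H x)\<^sup>2"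
    using assms by (simp add: hnorm_sq power_mult_distrib)
  then show ?thesis
    using assms by (simp add: power2_eq_iff_nonneg)
qed

lemma hnorm_minus_commute: 
  assumes "x \<in> Space H" "y \<in> Space H"
  shows "hnorm H (x - y) = hnorm H (y - x)"
  using hnorm_scl[of "x - y" "-1"] assms by simp

lemma hnorm_add_sq:
  assumes "x \<in> Space H" "y \<in> Space H"
  shows "(hnorm H (x + y))\<^sup>2 = (hnorm H x)\<^sup>2 + 2 * Re (ip H x y) + (hnorm H y)\<^sup>2"
  using assms ip_commute[of y x] by (simp add: hnorm_sq ip_add_left ip_add_right)

lemma Cauchy_Schwarz:
  assumes x: "x \<in> Space H" and y: "y \<in> Space H"
  shows "cmod (ip H x y) \<le> hnorm H x * hnorm H y"
proof (cases "y = 0")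
  case False
  define n where "n = (hnorm H y)\<^sup>2"
  \<comment> \<open>With this \<open>c\<close> the vector \<open>x + scl H c y\<close> is the
    component of \<open>x\<close> orthogonal to \<open>y\<close>; its squared norm is
    nonnegative.\<close>
  define c where "c = - (ip H x y / n)"
  have n: "n > 0"
    using False y by (simp add: n_def hnorm_eq_0)
  have "ip H x (scl H c y) = cnj c * ip H x y"
    using x y by (simp add: ip_scl_right)
  also have "\<dots> = - (ip H x y * cnj (ip H x y) / n)"
    by (simp add: c_def)
  also have "\<dots> = complex_of_real (- ((cmod (ip H x y))\<^sup>2 / n))"
    by (simp only: complex_norm_square[symmetric] of_real_divide of_real_minus)
  finally have "ip H x (scl H c y) = complex_of_real (- ((cmod (ip H x y))\<^sup>2 / n))" .
  then have 1: "Re (ip H x (scl H c y)) = - ((cmod (ip H x y))\<^sup>2 / n)"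
    by simp
  have 2: "(hnorm H (scl H c y))\<^sup>2 = (cmod (ip H x y))\<^sup>2 / n"
  proof -
    have "(hnorm H (scl H c y))\<^sup>2 = (cmod c)\<^sup>2 * n"
      using y by (simp add: hnorm_scl power_mult_distrib n_def)
    also have "\<dots> = (cmod (ip H x y))\<^sup>2 / n"
      using n by (simp add: c_def norm_divide power_divide power2_eq_square)
    finally show ?thesis .
  qed
  have "0 \<le> (hnorm H x)\<^sup>2 - (cmod (ip H x y))\<^sup>2 / n"
    using hnorm_add_sq[OF x scl_Space[OF y], of c] 1 2
      zero_le_power2[of "hnorm H (x + scl H c y)"] by linarith
  then have "(cmod (ip H x y))\<^sup>2 \<le> (hnorm H x)\<^sup>2 * n"
    using n by (simp add: pos_divide_le_eq)
  then have "(cmod (ip H x y))\<^sup>2 \<le> (hnorm H x * hnorm H y)\<^sup>2"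
    by (simp only: n_def power_mult_distrib)
  then show ?thesis
    by (rule power2_le_imp_le) (use x y in simp)
qed (use assms in simp)

lemma hnorm_triangle:
  assumes x: "x \<in> Space H" and y: "y \<in> Space H"
  shows "hnorm H (x + y) \<le> hnorm H x + hnorm H y"
proof (rule power2_le_imp_le)
  have "Re (ip H x y) \<le> hnorm H x * hnorm H y"
    using Cauchy_Schwarz[OF x y] complex_Re_le_cmod order_trans by blast
  then show "(hnorm H (x + y))\<^sup>2 \<le> (hnorm H x + hnorm H y)\<^sup>2"
    using hnorm_add_sq[OF x y] by (simp add: power2_sum)
qed (use x y in simp)

lemma hnorm_diff_triangle:
  assumes "x \<in> Space H" "y \<in> Space H" "z \<in> Space H"
  shows "hnorm H (x - z) \<le> hnorm H (x - y) + hnorm H (y - z)"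
  using hnorm_triangle[of "x - y" "y - z"] assms by simp

lemma hnorm_diff_le:
  assumes "x \<in> Space H" "y \<in> Space H"
  shows "hnorm H (x - y) \<le> hnorm H x + hnorm H y"
  using hnorm_diff_triangle[of x 0 y] assms hnorm_minus_commute[of 0 y] by simp

lemma hnorm_le_diff:
  assumes "x \<in> Space H" "y \<in> Space H"
  shows "hnorm H x \<le> hnorm H (x - y) + hnorm H y"
  using hnorm_triangle[of "x - y" y] assms by simp

text \<open>Meant for the limit operator in \<open>calc_exists\<close>, whose defect of additivity
  or homogeneity is bounded by the error of every single approximant.\<close>

lemma inverse_Suc_bound_imp_0:
  assumes x: "x \<in> Space H" and "\<And>n::nat. hnorm H x \<le> inverse (Suc n) * K"
  shows "x = 0"
proof -
  have "(\<lambda>n. inverse (real (Suc n)) * K) \<longlonglongrightarrow> 0 * K"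
    by (intro tendsto_mult LIMSEQ_inverse_real_of_nat tendsto_const)
  then have "hnorm H x \<le> 0 * K"
    by (rule tendsto_lowerbound) (use assms(2) in auto)
  then show ?thesis
    using hnorm_eq_0[OF x] hnorm_nonneg[OF x] by simp
qed

section \<open>Bounded operators and adjoints\<close>

lemma bounded_opsD:
  assumes "T \<in> bounded_ops H"
  shows "x \<in> Space H \<Longrightarrow> T x \<in> Space H"
    and "x \<in> Space H \<Longrightarrow> y \<in> Space H \<Longrightarrow> T (x + y) = T x + T y"
    and "x \<in> Space H \<Longrightarrow> T (scl H c x) = scl H c (T x)"
    and "T \<in> extensional (Space H)"
  using assms by (auto simp: bounded_ops_def PiE_def)

lemma bounded_ops_diff:
  assumes "T \<in> bounded_ops H" "x \<in> Space H" "y \<in> Space H"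
  shows "T (x - y) = T x - T y"
  using bounded_opsD(2)[OF assms(1), of "x - y" y] assms by simp

lemma bounded_ops_zero:
  assumes "T \<in> bounded_ops H"
  shows "T 0 = 0"
  using bounded_ops_diff[OF assms, of 0 0] by simp

text \<open>The constant in \<open>bounded_ops\<close> carries no sign, and on the zero space it may
  be negative; bounds for compositions multiply such constants and need them nonnegative.\<close>

lemma bounded_ops_bound:
  assumes "T \<in> bounded_ops H"
  shows "\<exists>K\<ge>0. \<forall>x\<in>Space H. hnorm H (T x) \<le> K * hnorm H x"
proof -
  obtain K where K: "\<And>x. x \<in> Space H \<Longrightarrow> hnorm H (T x) \<le> K * hnorm H x"
    using assms unfolding bounded_ops_def by blast
  have "hnorm H (T x) \<le> \<bar>K\<bar> * hnorm H x" if "x \<in> Space H" for x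
    using K[OF that] mult_right_mono[OF abs_ge_self[of K] hnorm_nonneg[OF that]] by linarith
  then show ?thesis
    by (intro exI[of _ "\<bar>K\<bar>"]) simp
qed

lemma bounded_opsI:
  assumes "\<And>x. x \<in> Space H \<Longrightarrow> T x \<in> Space H" "T \<in> extensional (Space H)"
    and "\<And>x y. x \<in> Space H \<Longrightarrow> y \<in> Space H \<Longrightarrow> T (x + y) = T x + T y"
    and "\<And>c x. x \<in> Space H \<Longrightarrow> T (scl H c x) = scl H c (T x)"
    and "\<And>x. x \<in> Space H \<Longrightarrow> hnorm H (T x) \<le> K * hnorm H x"
  shows "T \<in> bounded_ops H"
  unfolding bounded_ops_def mem_Collect_eq PiE_def
  by (intro conjI exI[of _ K]) (use assms in auto)

lemma bounded_ops_eqI: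
  assumes "S \<in> bounded_ops H" "T \<in> bounded_ops H" "\<And>x. x \<in> Space H \<Longrightarrow> S x = T x"
  shows "S = T"
  using assms by (meson bounded_opsD(4) extensionalityI)

lemma op_id_bounded [simp]: "op_id H \<in> bounded_ops H"
  by (rule bounded_opsI[where K = 1]) (auto simp: op_id_def)

lemma op_add_bounded [simp]:
  assumes S: "S \<in> bounded_ops H" and T: "T \<in> bounded_ops H"
  shows "op_add H S T \<in> bounded_ops H"
proof -
  obtain K where K: "\<forall>x\<in>Space H. hnorm H (S x) \<le> K * hnorm H x"
    using bounded_ops_bound[OF S] by blast
  obtain L where L: "\<forall>x\<in>Space H. hnorm H (T x) \<le> L * hnorm H x"
    using bounded_ops_bound[OF T] by blast
  show ?thesis
  proof (rule bounded_opsI[where K = "K + L"])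
    fix x assume x: "x \<in> Space H"
    have "hnorm H (S x + T x) \<le> hnorm H (S x) + hnorm H (T x)"
      by (intro hnorm_triangle bounded_opsD(1)[OF S] bounded_opsD(1)[OF T] x)
    also have "\<dots> \<le> K * hnorm H x + L * hnorm H x"
      using K L x by (intro add_mono) auto
    finally show "hnorm H (op_add H S T x) \<le> (K + L) * hnorm H x"
      using x by (simp add: op_add_def distrib_right)
  qed (use bounded_opsD[OF S] bounded_opsD[OF T] in
      \<open>simp_all add: op_add_def scale_right_distrib add_ac\<close>)
qed

lemma op_scl_bounded [simp]:
  assumes T: "T \<in> bounded_ops H"
  shows "op_scl H c T \<in> bounded_ops H"
proof -
  obtain K where K: "\<forall>x\<in>Space H. hnorm H (T x) \<le> K * hnorm H x"
    using bounded_ops_bound[OF T] by blast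
  show ?thesis
  proof (rule bounded_opsI[where K = "cmod c * K"])
    fix x assume x: "x \<in> Space H"
    show "hnorm H (op_scl H c T x) \<le> (cmod c * K) * hnorm H x"
      using K x bounded_opsD(1)[OF T x]
      by (simp add: op_scl_def hnorm_scl mult.assoc mult_left_mono)
  qed (use bounded_opsD[OF T] in
      \<open>simp_all add: op_scl_def scale_right_distrib mult.commute\<close>)
qed

lemma compose_bounded [simp]:
  assumes S: "S \<in> bounded_ops H" and T: "T \<in> bounded_ops H"
  shows "compose (Space H) S T \<in> bounded_ops H"
proof -
  obtain K where K: "K \<ge> 0" "\<forall>x\<in>Space H. hnorm H (S x) \<le> K * hnorm H x"
    using bounded_ops_bound[OF S] by blast
  obtain L where L: "\<forall>x\<in>Space H. hnorm H (T x) \<le> L * hnorm H x"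
    using bounded_ops_bound[OF T] by blast
  show ?thesis
  proof (rule bounded_opsI[where K = "K * L"])
    fix x assume x: "x \<in> Space H"
    have "hnorm H (S (T x)) \<le> K * hnorm H (T x)"
      using K bounded_opsD(1)[OF T x] by blast
    also have "\<dots> \<le> K * (L * hnorm H x)"
      using K L x by (intro mult_left_mono) auto
    finally show "hnorm H (compose (Space H) S T x) \<le> (K * L) * hnorm H x"
      using x by (simp add: compose_def mult.assoc)
  qed (use bounded_opsD[OF S] bounded_opsD[OF T] in \<open>simp_all add: compose_def\<close>)
qed

lemma op_diff_eq:
  assumes "S \<in> bounded_ops H" "T \<in> bounded_ops H"
  shows "op_diff H S T = op_add H S (op_scl H (-1) T)"
  using assms by (auto simp: op_diff_def op_add_def op_scl_def)

lemma op_diff_bounded [simp]: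
  "S \<in> bounded_ops H \<Longrightarrow> T \<in> bounded_ops H \<Longrightarrow> op_diff H S T \<in> bounded_ops H"
  by (simp add: op_diff_eq)

lemma is_adjointD:
  "is_adjoint H T S \<Longrightarrow> x \<in> Space H \<Longrightarrow> y \<in> Space H \<Longrightarrow> ip H (T x) y = ip H x (S y)"
  by (simp add: is_adjoint_def)

text \<open>Identifies the image of \<open>cnj z\<close> under a functional calculus, about which
  only an adjoint relation is given.\<close>

lemma is_adjoint_unique:
  assumes "is_adjoint H T S" "is_adjoint H T S'" "S \<in> bounded_ops H" "S' \<in> bounded_ops H"
  shows "S = S'"
proof (rule bounded_ops_eqI)
  fix x assume x: "x \<in> Space H"
  let ?d = "S x - S' x"
  have d: "?d \<in> Space H"
    using assms x by (simp add: bounded_opsD)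
  have *: "ip H ?d (S x) = ip H (T ?d) x" "ip H ?d (S' x) = ip H (T ?d) x"
    using is_adjointD[OF assms(1) d x] is_adjointD[OF assms(2) d x] by simp_all
  have "ip H ?d ?d = ip H ?d (S x) - ip H ?d (S' x)"
    using assms x d by (intro ip_diff_right) (simp_all add: bounded_opsD)
  also have "\<dots> = 0"
    unfolding * by simp
  finally show "S x = S' x"
    using ip_definite[OF d] by simp
qed (use assms in auto)

lemma is_adjoint_sym:
  assumes "is_adjoint H T S" "T \<in> bounded_ops H" "S \<in> bounded_ops H"
  shows "is_adjoint H S T"
  unfolding is_adjoint_def
proof (intro ballI)
  fix x y assume xy: "x \<in> Space H" "y \<in> Space H"
  have "ip H (S x) y = cnj (ip H y (S x))"
    using xy assms by (intro ip_commute) (simp_all add: bounded_opsD)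
  also have "\<dots> = cnj (ip H (T y) x)"
    using assms(1) xy by (simp add: is_adjoint_def)
  also have "\<dots> = ip H x (T y)"
    using xy assms by (intro ip_commute[symmetric]) (simp_all add: bounded_opsD)
  finally show "ip H (S x) y = ip H x (T y)" .
qed


section \<open>Operator norm, finite rank and singular values\<close>

lemma hnorm_le_op_norm:
  assumes T: "T \<in> bounded_ops H" and x: "x \<in> Space H"
  shows "hnorm H (T x) \<le> op_norm H T * hnorm H x"
proof (cases "x = 0")
  case True
  then show ?thesis by (simp add: bounded_ops_zero[OF T])
next
  case False
  define n where "n = hnorm H x"
  have n: "n > 0"
    using False x hnorm_eq_0[of x] hnorm_nonneg[of x] by (simp add: n_def less_le)
  define y where "y = scl H (complex_of_real (1 / n)) x"
  have y: "y \<in> Space H" "hnorm H y = 1"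
    using x n by (simp_all add: y_def hnorm_scl norm_divide flip: n_def)
  obtain K where K: "K \<ge> 0" "\<forall>x\<in>Space H. hnorm H (T x) \<le> K * hnorm H x"
    using bounded_ops_bound[OF T] by blast
  have "hnorm H (T y) \<le> op_norm H T"
    unfolding op_norm_def
  proof (rule cSup_upper)
    show "hnorm H (T y) \<in> {hnorm H (T x) |x. x \<in> Space H \<and> hnorm H x \<le> 1}"
      using y by auto
    show "bdd_above {hnorm H (T x) |x. x \<in> Space H \<and> hnorm H x \<le> 1}"
    proof (rule bdd_aboveI)
      fix r assume "r \<in> {hnorm H (T x) |x. x \<in> Space H \<and> hnorm H x \<le> 1}"
      then obtain x where "r = hnorm H (T x)" "x \<in> Space H" "hnorm H x \<le> 1" by blast
      then show "r \<le> K"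
        using K mult_left_mono[of "hnorm H x" 1 K] by fastforce
    qed
  qed
  moreover have "hnorm H (T y) = hnorm H (T x) / n"
    using x n bounded_opsD(1,3)[OF T] by (simp add: y_def hnorm_scl norm_divide)
  ultimately show ?thesis
    using n by (simp add: pos_divide_le_eq n_def)
qed

lemma finite_rank_kernel:
  assumes R: "R \<in> bounded_ops H" and rank: "op_rank H R \<le> enat m"
    and I: "finite I" "m < card I" and e: "\<And>j. j \<in> I \<Longrightarrow> e j \<in> Space H"
  shows "\<exists>u. (\<exists>j\<in>I. u j \<noteq> 0) \<and> R (\<Sum>j\<in>I. scl H (u j) (e j)) = 0"
proof -
  have R_sum: "R (\<Sum>j\<in>J. scl H (u j) (e j)) = (\<Sum>j\<in>J. scl H (u j) (R (e j)))" if "J \<subseteq> I" for u J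
    using finite_subset[OF that I(1)] that
  proof (induction J rule: finite_induct)
    case (insert j J)
    then show ?case
      using e bounded_opsD(2)[OF R, of "scl H (u j) (e j)" "\<Sum>j\<in>J. scl H (u j) (e j)"]
      by (auto simp: bounded_opsD(3)[OF R] sum_Space subset_iff)
  qed (simp add: bounded_ops_zero[OF R])
  show ?thesis
  \<comment> \<open>More than \<open>m\<close> images in a space of dimension at most
    \<open>m\<close> satisfy a nontrivial relation. As \<open>dependent\<close> speaks of sets and
    the images form a family, a repeated image is treated by itself, with coefficients
    \<open>1\<close> and \<open>-1\<close>.\<close>
  proof (cases "inj_on (\<lambda>j. R (e j)) I")
    case False
    then obtain j k where jk: "j \<in> I" "k \<in> I" "j \<noteq> k" "R (e j) = R (e k)"
      by (auto simp: inj_on_def)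
    define u where "u i = (if i = j then 1 :: complex else if i = k then -1 else 0)" for i
    have "(\<Sum>i\<in>I. scl H (u i) (R (e i))) = (\<Sum>i\<in>{j, k}. scl H (u i) (R (e i)))"
      using I(1) jk by (intro sum.mono_neutral_right) (auto simp: u_def)
    also have "\<dots> = 0"
      using jk by (simp add: u_def)
    finally have "R (\<Sum>i\<in>I. scl H (u i) (e i)) = 0"
      using R_sum[of I u] by simp
    moreover have "u j \<noteq> 0" by (simp add: u_def)
    ultimately show ?thesis using jk(1) by blast
  next
    case True
    let ?E = "(\<lambda>j. R (e j)) ` I"
    \<comment> \<open>The finite spanning set is what \<open>op_rank\<close> being finite provides;
      it makes the basis \<open>C\<close> finite, so that \<open>card C\<close> can be compared with
      \<open>card ?E\<close>.\<close>
    obtain B where B: "finite B" "R ` Space H \<subseteq> span B" and dim: "dim (R ` Space H) \<le> m"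
      using rank unfolding op_rank_def by (auto split: if_splits)
    obtain C where C: "C \<subseteq> R ` Space H" "independent C" "R ` Space H \<subseteq> span C" "card C = dim (R ` Space H)"
      using basis_exists by blast
    have "C \<subseteq> span B"
      using B(2) C(1) by blast
    then have "finite C"
      using independent_span_bound[OF B(1) C(2)] by simp
    have "?E \<subseteq> span C"
      using C(3) e by blast
    have "dependent ?E"
    proof (rule ccontr)
      assume "independent ?E"
      then have "card ?E \<le> card C"
        using independent_span_bound[OF \<open>finite C\<close> _ \<open>?E \<subseteq> span C\<close>] by simp
      then show False
        using True I dim C(4) by (simp add: card_image)
    qed
    then obtain v where v: "\<exists>w\<in>?E. v w \<noteq> 0" "(\<Sum>w\<in>?E. scl H (v w) w) = 0"
      using dependent_finite[of ?E] I(1) by auto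
    have "R (\<Sum>j\<in>I. scl H (v (R (e j))) (e j)) = 0"
      using v(2) R_sum[of I "\<lambda>j. v (R (e j))"] by (simp add: sum.reindex[OF True])
    then show ?thesis
      using v(1) by (intro exI[of _ "\<lambda>j. v (R (e j))"]) auto
  qed
qed

text \<open>An \<open>R\<close> of rank at most \<open>m\<close> kills some nonzero vector of the
  span, whose dimension exceeds \<open>m\<close>. There \<open>D - R\<close> agrees with
  \<open>D\<close>, so its norm is at least \<open>c\<close>.\<close>

lemma singular_value_ge:
  assumes D: "D \<in> bounded_ops H" and I: "finite I" "m < card I"
    and e: "\<And>j. j \<in> I \<Longrightarrow> e j \<in> Space H"
    and indep: "\<And>u. (\<Sum>j\<in>I. scl H (u j) (e j)) = 0 \<Longrightarrow> \<forall>j\<in>I. u j = 0"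
    and lower: "\<And>u. c * hnorm H (\<Sum>j\<in>I. scl H (u j) (e j)) \<le> hnorm H (D (\<Sum>j\<in>I. scl H (u j) (e j)))"
  shows "c \<le> singular_value H D m"
  unfolding singular_value_def
proof (rule cInf_greatest)
  \<comment> \<open>The zero operator keeps the set under \<open>Inf\<close> nonempty, as
    \<open>cInf_greatest\<close> demands.\<close>
  have zero: "(\<lambda>x\<in>Space H. 0) \<in> bounded_ops H"
    by (rule bounded_opsI[where K = 0]) auto
  have "(\<lambda>x\<in>Space H. 0) ` Space H \<subseteq> span {}"
    by (auto simp: span_zero)
  then have "op_rank H (\<lambda>x\<in>Space H. 0) \<le> enat m"
    unfolding op_rank_def using dim_le_card[of "(\<lambda>x\<in>Space H. 0) ` Space H" "{}"] by auto
  then show "{op_norm H (op_diff H D R) |R. R \<in> bounded_ops H \<and> op_rank H R \<le> enat m} \<noteq> {}"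
    using zero by blast
next
  fix s assume "s \<in> {op_norm H (op_diff H D R) |R. R \<in> bounded_ops H \<and> op_rank H R \<le> enat m}"
  then obtain R where R: "R \<in> bounded_ops H" "op_rank H R \<le> enat m" and s: "s = op_norm H (op_diff H D R)"
    by auto
  have "\<exists>u. (\<exists>j\<in>I. u j \<noteq> 0) \<and> R (\<Sum>j\<in>I. scl H (u j) (e j)) = 0"
    by (rule finite_rank_kernel[OF R I e])
  then obtain u where u: "\<exists>j\<in>I. u j \<noteq> 0" "R (\<Sum>j\<in>I. scl H (u j) (e j)) = 0"
    by (elim exE conjE)
  define x where "x = (\<Sum>j\<in>I. scl H (u j) (e j))"
  have x: "x \<in> Space H"
    unfolding x_def using e by (intro sum_Space scl_Space)
  have "x \<noteq> 0"
    using indep[of u] u(1) by (auto simp: x_def)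
  then have pos: "hnorm H x > 0"
    using x hnorm_eq_0[of x] hnorm_nonneg[of x] by (simp add: less_le)
  have "c * hnorm H x \<le> hnorm H (op_diff H D R x)"
    using lower[of u] u(2) x by (simp add: op_diff_def flip: x_def)
  also have "\<dots> \<le> s * hnorm H x"
    unfolding s using D R(1) x by (intro hnorm_le_op_norm) auto
  finally show "c \<le> s"
    using pos by simp
qed

end

section \<open>Functional calculus of a unitary operator\<close>

text \<open>Cauchy's inequality on the unit disc. A symbol is controlled only on the circle, whereas
  coefficient bounds carry over to operators term by term.\<close>

lemma norm_coeff_le:
  fixes p :: "complex poly"
  assumes "\<And>z. cmod z = 1 \<Longrightarrow> cmod (poly p z) \<le> B"
  shows "cmod (coeff p n) \<le> B"
proof -
  have deriv_poly: "(deriv ^^ n) (poly p) = poly ((pderiv ^^ n) p)"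
  proof (induction n)
    case (Suc n)
    have "deriv (poly ((pderiv ^^ n) p)) = poly (pderiv ((pderiv ^^ n) p))"
      by (intro ext DERIV_imp_deriv poly_DERIV)
    then show ?case
      by (simp add: Suc.IH)
  qed simp
  have "cmod ((deriv ^^ n) (poly p) 0) \<le> fact n * B / 1 ^ n"
    by (rule Cauchy_inequality) (use assms in \<open>auto intro!: holomorphic_intros continuous_intros\<close>)
  moreover have "(deriv ^^ n) (poly p) 0 = fact n * coeff p n"
    by (simp add: deriv_poly poly_0_coeff_0 coeff_higher_pderiv pochhammer_fact)
  ultimately show ?thesis
    by (simp add: norm_mult)
qed

text \<open>For \<open>r = 1 + t\<close> with \<open>t > 0\<close>, Bernoulli's inequality gives
  linear growth in the exponent, which is no better than the assumed bound. Applied at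
  \<open>2 ^ k\<close> and squared, it gives quadratic growth at exponent
  \<open>2 ^ Suc k\<close>.\<close>

lemma base_le_1_of_power_bound:
  fixes r D :: real
  assumes "\<And>k::nat. r ^ (2 ^ k) \<le> 2 ^ k * D + 1" and "D \<ge> 0"
  shows "r \<le> 1"
proof (rule ccontr)
  assume "\<not> r \<le> 1"
  define t where "t = r - 1"
  have t: "t > 0" and r: "r = 1 + t"
    using \<open>\<not> r \<le> 1\<close> by (auto simp: t_def)
  have bound: "of_nat k * t\<^sup>2 \<le> 2 * D" for k :: nat
  proof -
    define m :: real where "m = 2 ^ k"
    have m: "m \<ge> of_nat k" "m > 0"
      by (auto simp: m_def of_nat_less_two_power less_imp_le)
    have "(1 + m * t) ^ 2 \<le> ((1 + t) ^ (2 ^ k)) ^ 2"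
      using Bernoulli_inequality[of t "2 ^ k"] t m
      by (intro power_mono) (auto simp: m_def)
    also have "\<dots> = r ^ (2 ^ Suc k)"
      by (simp add: r power_mult[symmetric] mult.commute)
    also have "\<dots> \<le> 2 * m * D + 1"
      using assms(1)[of "Suc k"] by (simp add: m_def)
    finally have "m * (m * t\<^sup>2 + 2 * t) \<le> m * (2 * D)"
      by (simp add: power2_eq_square algebra_simps)
    then have "m * t\<^sup>2 \<le> 2 * D"
      using m t by (auto simp: mult_le_cancel_left)
    then show ?thesis
      using mult_right_mono[OF m(1), of "t\<^sup>2"] zero_le_power2[of t] by linarith
  qed
  obtain k :: nat where "2 * D < of_nat k * t\<^sup>2"
    using t ex_less_of_nat_mult[of "t\<^sup>2" "2 * D"] by auto
  with bound[of k] show False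
    by linarith
qed

text \<open>The adjoint is a parameter rather than an existential witness, so that polynomials in
  \<open>U\<close> and \<open>Us\<close> can be written down and interpretations name the
  inverse.\<close>

locale unitary_operator = hilbert_space H
  for H :: "('v::ab_group_add) inner_space" and U Us :: "'v \<Rightarrow> 'v" +
  assumes U_bounded [simp]: "U \<in> bounded_ops H" and Us_bounded [simp]: "Us \<in> bounded_ops H"
    and U_adjoint: "is_adjoint H U Us"
    and Us_U [simp]: "x \<in> Space H \<Longrightarrow> Us (U x) = x"
    and U_Us [simp]: "x \<in> Space H \<Longrightarrow> U (Us x) = x"
begin

section \<open>Polynomials in a unitary operator and its adjoint\<close>

lemma U_Space [simp]: "x \<in> Space H \<Longrightarrow> U x \<in> Space H"
  and Us_Space [simp]: "x \<in> Space H \<Longrightarrow> Us x \<in> Space H"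
  using bounded_opsD(1) by auto

lemma hnorm_U [simp]: 
  assumes "x \<in> Space H"
  shows "hnorm H (U x) = hnorm H x"
  using is_adjointD[OF U_adjoint, of x "U x"] assms by (simp add: hnorm_def)

lemma unitary_U: "unitary H U"
  unfolding unitary_def
  by (intro conjI bexI[of _ Us]) (auto simp: U_adjoint compose_def op_id_def)

text \<open>\<open>laurent f T\<close>: \<open>f\<close> is a polynomial in \<open>z\<close> and \<open>cnj z\<close>, and \<open>T\<close> is the same polynomial in \<open>U\<close> and
  \<open>U\<^sup>*\<close>. A relation rather than a function, as \<open>f\<close> has several such representations.\<close>

inductive laurent :: "(complex \<Rightarrow> complex) \<Rightarrow> ('v \<Rightarrow> 'v) \<Rightarrow> bool" where
  one: "laurent (\<lambda>z. 1) (op_id H)"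
| ident: "laurent (\<lambda>z. z) U"
| conj: "laurent (\<lambda>z. cnj z) Us"
| add: "laurent f S \<Longrightarrow> laurent g T \<Longrightarrow> laurent (\<lambda>z. f z + g z) (op_add H S T)"
| scl: "laurent f T \<Longrightarrow> laurent (\<lambda>z. c * f z) (op_scl H c T)"
| mult: "laurent f S \<Longrightarrow> laurent g T \<Longrightarrow> laurent (\<lambda>z. f z * g z) (compose (Space H) S T)"

lemma laurent_bounded: "laurent f T \<Longrightarrow> T \<in> bounded_ops H"
  by (induction rule: laurent.induct) auto

lemma laurent_Space: "laurent f T \<Longrightarrow> x \<in> Space H \<Longrightarrow> T x \<in> Space H"
  using laurent_bounded bounded_opsD(1) by blast

lemma laurent_continuous: "laurent f T \<Longrightarrow> continuous_on A f"
  by (induction rule: laurent.induct) (auto intro!: continuous_intros)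

text \<open>Stated for a general \<open>C\<close> because \<open>laurent_commute\<close> uses it
  twice: with \<open>C\<close> equal to \<open>U\<close> or \<open>Us\<close>, and then with
  \<open>C\<close> a Laurent polynomial, which by then is known to commute with both.\<close>

lemma laurent_commute_with:
  assumes C: "C \<in> bounded_ops H" "\<forall>x\<in>Space H. C (U x) = U (C x)"
      "\<forall>x\<in>Space H. C (Us x) = Us (C x)"
    and "laurent f T"
  shows "\<forall>x\<in>Space H. C (T x) = T (C x)"
  using assms(4)
proof (induction rule: laurent.induct)
  case (add f S g T)
  then show ?case
    using laurent_Space bounded_opsD[OF C(1)] by (simp add: op_add_def)
next
  case (scl f T c)
  then show ?case
    using laurent_Space bounded_opsD[OF C(1)] by (simp add: op_scl_def)
next
  case (mult f S g T)
  then show ?case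
    using laurent_Space bounded_opsD[OF C(1)] by (simp add: compose_def)
qed (use C bounded_opsD[OF C(1)] in \<open>auto simp: op_id_def\<close>)

lemma laurent_commute:
  assumes f: "laurent f S" and g: "laurent g T" and "x \<in> Space H"
  shows "S (T x) = T (S x)"
proof -
  have U: "\<forall>x\<in>Space H. U (S x) = S (U x)" and Us: "\<forall>x\<in>Space H. Us (S x) = S (Us x)"
    by (rule laurent_commute_with[OF _ _ _ f]; simp)+
  show ?thesis
    using laurent_commute_with[OF laurent_bounded[OF f] _ _ g] U Us assms(3) by simp
qed

lemma laurent_adjoint:
  "laurent f T \<Longrightarrow> \<exists>T'. laurent (\<lambda>z. cnj (f z)) T' \<and> is_adjoint H T T'"
proof (induction rule: laurent.induct)
  case one
  have "is_adjoint H (op_id H) (op_id H)"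
    by (simp add: is_adjoint_def op_id_def)
  then show ?case
    using laurent.one by auto
next
  case ident
  then show ?case
    using laurent.conj U_adjoint by blast
next
  case conj
  then show ?case
    using laurent.ident is_adjoint_sym[OF U_adjoint] by auto
next
  case (add f S g T)
  then obtain S' T' where *: "laurent (\<lambda>z. cnj (f z)) S'" "is_adjoint H S S'"
      "laurent (\<lambda>z. cnj (g z)) T'" "is_adjoint H T T'" by blast
  show ?case
  proof (intro exI conjI)
    show "laurent (\<lambda>z. cnj (f z + g z)) (op_add H S' T')"
      using laurent.add[OF *(1,3)] by simp
    show "is_adjoint H (op_add H S T) (op_add H S' T')"
      using * add laurent_Space
      by (simp add: is_adjoint_def op_add_def ip_add_left ip_add_right)
  qed
next
  case (scl f T c)
  then obtain T' where *: "laurent (\<lambda>z. cnj (f z)) T'" "is_adjoint H T T'" by blast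
  show ?case
  proof (intro exI conjI)
    show "laurent (\<lambda>z. cnj (c * f z)) (op_scl H (cnj c) T')"
      using laurent.scl[OF *(1)] by simp
    show "is_adjoint H (op_scl H c T) (op_scl H (cnj c) T')"
      using * scl laurent_Space
      by (simp add: is_adjoint_def op_scl_def ip_scl_left ip_scl_right)
  qed
next
  case (mult f S g T)
  then obtain S' T' where *: "laurent (\<lambda>z. cnj (f z)) S'" "is_adjoint H S S'"
      "laurent (\<lambda>z. cnj (g z)) T'" "is_adjoint H T T'" by blast
  show ?case
  proof (intro exI conjI)
    show "laurent (\<lambda>z. cnj (f z * g z)) (compose (Space H) S' T')"
      using laurent.mult[OF *(1,3)] by simp
    show "is_adjoint H (compose (Space H) S T) (compose (Space H) S' T')"
      unfolding is_adjoint_def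
    proof (intro ballI)
      fix x y assume xy: "x \<in> Space H" "y \<in> Space H"
      have "ip H (S (T x)) y = ip H (T x) (S' y)"
        using xy mult laurent_Space by (intro is_adjointD[OF *(2)])
      also have "\<dots> = ip H x (T' (S' y))"
        using xy * laurent_Space by (intro is_adjointD[OF *(4)])
      \<comment> \<open>The adjoint of a product has its factors reversed; commutativity restores
        the order of the symbol.\<close>
      also have "T' (S' y) = S' (T' y)"
        using laurent_commute[OF *(3,1)] xy by simp
      finally show "ip H (compose (Space H) S T x) y = ip H x (compose (Space H) S' T' y)"
        using xy by (simp add: compose_def)
    qed
  qed
qed

text \<open>Normality gives \<open>T' (T x)\<close> and \<open>T (T x)\<close> the same norm, and
  the squared norm of \<open>T x\<close> is the inner product of \<open>T' (T x)\<close> with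
  \<open>x\<close>; Cauchy-Schwarz does the rest.\<close>

lemma laurent_normal:
  assumes "laurent f T" and x: "x \<in> Space H"
  shows "(hnorm H (T x))\<^sup>2 \<le> hnorm H (T (T x)) * hnorm H x"
proof -
  obtain T' where T': "laurent (\<lambda>z. cnj (f z)) T'" "is_adjoint H T T'"
    using laurent_adjoint[OF assms(1)] by blast
  have T'T: "is_adjoint H T' T"
    by (rule is_adjoint_sym[OF T'(2) laurent_bounded[OF assms(1)] laurent_bounded[OF T'(1)]])
  have sp: "T y \<in> Space H" "T' y \<in> Space H" if "y \<in> Space H" for y
    using that assms(1) T'(1) laurent_Space by auto
  have "ip H (T' (T x)) (T' (T x)) = ip H (T (T' (T x))) (T x)"
    using is_adjointD[OF T'(2), of "T' (T x)" "T x"] sp x by simp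
  also have "T (T' (T x)) = T' (T (T x))"
    using laurent_commute[OF assms(1) T'(1)] sp x by simp
  also have "ip H (T' (T (T x))) (T x) = ip H (T (T x)) (T (T x))"
    using is_adjointD[OF T'T, of "T (T x)" "T x"] sp x by simp
  finally have eq: "hnorm H (T' (T x)) = hnorm H (T (T x))"
    by (simp add: hnorm_def)
  have "complex_of_real ((hnorm H (T x))\<^sup>2) = ip H (T' (T x)) x"
    using is_adjointD[OF T'T, of "T x" x] sp x by (simp add: ip_eq_hnorm)
  then have "(hnorm H (T x))\<^sup>2 = cmod (ip H (T' (T x)) x)"
    by (metis abs_of_nonneg norm_of_real zero_le_power2)
  also have "\<dots> \<le> hnorm H (T' (T x)) * hnorm H x"
    using sp x by (intro Cauchy_Schwarz) auto
  finally show ?thesis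
    by (simp only: eq)
qed

text \<open>The iterate \<open>T ^^ m\<close> need not be extensional (for \<open>m = 0\<close> it
  is the identity on the whole type), hence an operator \<open>P\<close> that agrees with it on the
  space.\<close>

lemma laurent_power:
  assumes "laurent f T"
  shows "\<exists>P. laurent (\<lambda>z. f z ^ m) P \<and> (\<forall>x\<in>Space H. P x = (T ^^ m) x)"
proof (induction m)
  case 0
  have "\<forall>x\<in>Space H. op_id H x = (T ^^ 0) x"
    by (simp add: op_id_def)
  then show ?case
    using laurent.one by auto
next
  case (Suc m)
  then obtain P where P: "laurent (\<lambda>z. f z ^ m) P" "\<forall>x\<in>Space H. P x = (T ^^ m) x"
    by blast
  have "\<forall>x\<in>Space H. compose (Space H) T P x = (T ^^ Suc m) x"
    using P(2) by (simp add: compose_def)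
  with laurent.mult[OF assms P(1)] show ?case
    unfolding power_Suc by blast
qed

section \<open>Norm bound for Laurent polynomials\<close>

definition poly_op :: "complex poly \<Rightarrow> 'v \<Rightarrow> 'v" where
  "poly_op p = fold_coeffs (\<lambda>a T x. scl H a x + U (T x)) p (\<lambda>x. 0)"

lemma poly_op_0 [simp]: "poly_op 0 x = 0"
  by (simp add: poly_op_def)

lemma poly_op_pCons [simp]:
  "x \<in> Space H \<Longrightarrow> poly_op (pCons a p) x = scl H a x + U (poly_op p x)"
  by (cases "pCons a p = 0") (auto simp: poly_op_def bounded_ops_zero)

lemma poly_op_Space [simp]: "x \<in> Space H \<Longrightarrow> poly_op p x \<in> Space H"
  by (induction p) auto

lemma poly_op_add [simp]:
  assumes "x \<in> Space H"
  shows "poly_op (p + q) x = poly_op p x + poly_op q x"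
  by (induction p q rule: poly_induct2)
     (use assms in \<open>simp_all add: scale_left_distrib bounded_opsD(2)[OF U_bounded] add_ac\<close>)

lemma poly_op_smult [simp]:
  "x \<in> Space H \<Longrightarrow> poly_op (smult c p) x = scl H c (poly_op p x)"
  by (induction p) (simp_all add: scale_right_distrib bounded_opsD(3)[OF U_bounded])

lemma poly_op_U: "x \<in> Space H \<Longrightarrow> poly_op p (U x) = U (poly_op p x)"
  by (induction p) (simp_all add: bounded_ops_zero bounded_opsD[OF U_bounded])

lemma poly_op_mult [simp]:
  "x \<in> Space H \<Longrightarrow> poly_op (p * q) x = poly_op p (poly_op q x)"
  by (induction p) (simp_all add: mult_pCons_left)

text \<open>Triangle inequality over at most \<open>n + 1\<close> terms, \<open>U\<close> being
  isometric. Since the powers of \<open>U\<close> are ignored otherwise, a factor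
  \<open>n + 1\<close> is lost.\<close>

lemma hnorm_poly_op_le:
  assumes x: "x \<in> Space H"
  shows "\<lbrakk>degree p \<le> n; \<And>i. cmod (coeff p i) \<le> B\<rbrakk> \<Longrightarrow> hnorm H (poly_op p x) \<le> (real n + 1) * B * hnorm H x"
proof (induction n arbitrary: p)
  case 0
  obtain a where p: "p = [:a:]"
    using 0(1) by (auto elim: degree_eq_zeroE)
  have "cmod a \<le> B" using 0(2)[of 0] by (simp add: p)
  then show ?case
    using x by (simp add: p hnorm_scl bounded_ops_zero mult_right_mono)
next
  case (Suc n)
  obtain a q where p: "p = pCons a q" by (cases p)
  have q: "degree q \<le> n" using Suc.prems(1) by (auto simp: p split: if_splits)
  have a: "cmod a \<le> B" using Suc.prems(2)[of 0] by (simp add: p)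
  have "cmod (coeff q i) \<le> B" for i
    using Suc.prems(2)[of "Suc i"] by (simp add: p)
  then have IH: "hnorm H (poly_op q x) \<le> (real n + 1) * B * hnorm H x"
    by (rule Suc.IH[OF q])
  have "hnorm H (poly_op p x) \<le> hnorm H (scl H a x) + hnorm H (U (poly_op q x))"
    using hnorm_triangle[of "scl H a x" "U (poly_op q x)"] x by (simp add: p del: hnorm_U)
  also have "\<dots> \<le> B * hnorm H x + (real n + 1) * B * hnorm H x"
    using IH a x by (intro add_mono) (simp_all add: hnorm_scl mult_right_mono)
  finally show ?case
    by (simp add: algebra_simps)
qed

lemma U_pow_Space [simp]: "x \<in> Space H \<Longrightarrow> (U ^^ d) x \<in> Space H"
  by (induction d) auto

lemma hnorm_U_pow [simp]: "x \<in> Space H \<Longrightarrow> hnorm H ((U ^^ d) x) = hnorm H x"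
  by (induction d) auto

lemma poly_op_monom_mult: "x \<in> Space H \<Longrightarrow> poly_op (monom 1 d * p) x = (U ^^ d) (poly_op p x)"
  by (induction d) (simp_all add: monom_Suc mult_pCons_left)

lemma U_pow_add: "x \<in> Space H \<Longrightarrow> y \<in> Space H \<Longrightarrow> (U ^^ d) (x + y) = (U ^^ d) x + (U ^^ d) y"
  by (induction d) (simp_all add: bounded_opsD[OF U_bounded])

lemma U_pow_scl: "x \<in> Space H \<Longrightarrow> (U ^^ d) (scl H c x) = scl H c ((U ^^ d) x)"
  by (induction d) (simp_all add: bounded_opsD[OF U_bounded])

lemma U_pow_laurent: "laurent f T \<Longrightarrow> x \<in> Space H \<Longrightarrow> (U ^^ d) (T x) = T ((U ^^ d) x)"
  by (induction d) (simp_all add: laurent_commute[OF laurent.ident])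

lemma poly_op_U_pow: "x \<in> Space H \<Longrightarrow> (U ^^ d) (poly_op p x) = poly_op p ((U ^^ d) x)"
  by (induction d) (simp_all add: poly_op_U)

text \<open>On the circle \<open>cnj z\<close> is the inverse of \<open>z\<close>, so a power of
  \<open>z\<close> clears all conjugates; on the operator side the corresponding power of
  \<open>U\<close> preserves norms. The result is an honest polynomial, to which
  \<open>norm_coeff_le\<close> applies.\<close>

lemma laurent_poly:
  assumes "laurent f T"
  shows "\<exists>d p. (\<forall>z. cmod z = 1 \<longrightarrow> z ^ d * f z = poly p z) \<and>
           (\<forall>x\<in>Space H. (U ^^ d) (T x) = poly_op p x)"
  using assms
proof (induction rule: laurent.induct)
  case one
  show ?case
    by (intro exI[of _ 0] exI[of _ 1]) (auto simp: op_id_def one_pCons bounded_ops_zero)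
next
  case ident
  show ?case
    by (intro exI[of _ 0] exI[of _ "[:0, 1:]"]) (auto simp: bounded_ops_zero)
next
  case conj
  show ?case
    by (intro exI[of _ 1] exI[of _ "[:1:]"])
       (auto simp: bounded_ops_zero complex_norm_square[symmetric])
next
  case (add f S g T)
  then obtain d p e q where *:
      "\<And>z. cmod z = 1 \<Longrightarrow> z ^ d * f z = poly p z" "\<And>x. x \<in> Space H \<Longrightarrow> (U ^^ d) (S x) = poly_op p x"
      "\<And>z. cmod z = 1 \<Longrightarrow> z ^ e * g z = poly q z" "\<And>x. x \<in> Space H \<Longrightarrow> (U ^^ e) (T x) = poly_op q x"
    by metis
  show ?case
  proof (intro exI conjI allI impI ballI)
    fix z :: complex assume z: "cmod z = 1"
    have "z ^ (d + e) * (f z + g z) = z ^ e * (z ^ d * f z) + z ^ d * (z ^ e * g z)"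
      by (simp add: power_add algebra_simps)
    then show "z ^ (d + e) * (f z + g z) = poly (monom 1 e * p + monom 1 d * q) z"
      using *(1,3)[OF z] by (simp add: poly_monom)
  next
    fix x assume x: "x \<in> Space H"
    have "(U ^^ (d + e)) (S x) = (U ^^ e) ((U ^^ d) (S x))"
      by (metis add.commute comp_apply funpow_add)
    moreover have "(U ^^ (d + e)) (T x) = (U ^^ d) ((U ^^ e) (T x))"
      by (simp add: funpow_add)
    ultimately show "(U ^^ (d + e)) (op_add H S T x) = poly_op (monom 1 e * p + monom 1 d * q) x"
      using x laurent_Space[OF add.hyps(1)] laurent_Space[OF add.hyps(2)]
      by (simp del: poly_op_mult add: op_add_def U_pow_add poly_op_monom_mult *(2,4))
  qed
next
  case (scl f T c)
  then obtain d p where *: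
      "\<And>z. cmod z = 1 \<Longrightarrow> z ^ d * f z = poly p z" "\<And>x. x \<in> Space H \<Longrightarrow> (U ^^ d) (T x) = poly_op p x"
    by metis
  show ?case
    by (intro exI[of _ d] exI[of _ "smult c p"])
       (use * laurent_Space[OF scl.hyps] in \<open>auto simp: op_scl_def U_pow_scl algebra_simps\<close>)
next
  case (mult f S g T)
  then obtain d p e q where *:
      "\<And>z. cmod z = 1 \<Longrightarrow> z ^ d * f z = poly p z" "\<And>x. x \<in> Space H \<Longrightarrow> (U ^^ d) (S x) = poly_op p x"
      "\<And>z. cmod z = 1 \<Longrightarrow> z ^ e * g z = poly q z" "\<And>x. x \<in> Space H \<Longrightarrow> (U ^^ e) (T x) = poly_op q x"
    by metis
  show ?case
  proof (intro exI conjI allI impI ballI)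
    fix z :: complex assume z: "cmod z = 1"
    have "z ^ (d + e) * (f z * g z) = (z ^ d * f z) * (z ^ e * g z)"
      by (simp add: power_add algebra_simps)
    then show "z ^ (d + e) * (f z * g z) = poly (p * q) z"
      using *(1,3)[OF z] by simp
  next
    fix x assume x: "x \<in> Space H"
    have "(U ^^ (d + e)) (S (T x)) = (U ^^ d) ((U ^^ e) (S (T x)))"
      by (simp add: funpow_add)
    also have "(U ^^ e) (S (T x)) = S (poly_op q x)"
      using x laurent_Space[OF mult.hyps(2)] by (simp add: U_pow_laurent[OF mult.hyps(1)] *(4))
    also have "(U ^^ d) (S (poly_op q x)) = poly_op p (poly_op q x)"
      using x by (simp add: *(2))
    finally show "(U ^^ (d + e)) (compose (Space H) S T x) = poly_op (p * q) x"
      using x by (simp add: compose_def)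
  qed
qed

text \<open>One \<open>D\<close> serves all \<open>m\<close>, because \<open>p ^ m\<close> has
  degree at most \<open>m * degree p\<close>: the number of coefficients, the only loss, grows
  linearly while the circle bound is exactly multiplicative.\<close>

lemma laurent_power_bound:
  assumes "laurent f T" and M: "\<And>z. cmod z = 1 \<Longrightarrow> cmod (f z) \<le> M"
  obtains D :: nat where
    "\<And>m x. x \<in> Space H \<Longrightarrow> hnorm H ((T ^^ m) x) \<le> (real m * real D + 1) * M ^ m * hnorm H x"
proof -
  obtain d p where *: "\<And>z. cmod z = 1 \<Longrightarrow> z ^ d * f z = poly p z"
      "\<And>x. x \<in> Space H \<Longrightarrow> (U ^^ d) (T x) = poly_op p x"
    using laurent_poly[OF assms(1)] by blast
  have T: "(T ^^ m) x \<in> Space H" if "x \<in> Space H" for m x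
    by (induction m) (use that laurent_Space[OF assms(1)] in auto)
  have pow: "(U ^^ (d * m)) ((T ^^ m) x) = poly_op (p ^ m) x" if x: "x \<in> Space H" for m x
  proof (induction m)
    case 0
    then show ?case using x by (simp add: one_pCons bounded_ops_zero)
  next
    case (Suc m)
    have "(U ^^ (d * Suc m)) ((T ^^ Suc m) x) = (U ^^ (d * m)) ((U ^^ d) (T ((T ^^ m) x)))"
      by (metis mult_Suc_right add.commute comp_apply funpow_add funpow.simps(2))
    also have "\<dots> = poly_op p ((U ^^ (d * m)) ((T ^^ m) x))"
      using T[OF x] by (simp add: *(2) poly_op_U_pow)
    also have "\<dots> = poly_op (p ^ Suc m) x"
      using x by (simp add: Suc.IH)
    finally show ?case .
  qed
  have "hnorm H ((T ^^ m) x) \<le> (real m * real (degree p) + 1) * M ^ m * hnorm H x"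
    if x: "x \<in> Space H" for m x
  proof -
    have "cmod (poly (p ^ m) z) \<le> M ^ m" if z: "cmod z = 1" for z
    proof -
      have "cmod (poly p z) = cmod (f z)"
        unfolding *(1)[OF z, symmetric] using z by (simp add: norm_mult norm_power)
      then show ?thesis
        using M[OF z] by (simp add: poly_power norm_power power_mono)
    qed
    then have "hnorm H (poly_op (p ^ m) x) \<le> (real (m * degree p) + 1) * M ^ m * hnorm H x"
      by (intro hnorm_poly_op_le[OF x] norm_coeff_le) (use degree_power_le[of p m] in \<open>simp_all add: mult.commute\<close>)
    then show ?thesis
      using pow[OF x, of m] hnorm_U_pow[OF T[OF x], of "d * m" m] by simp
  qed
  then show ?thesis
    by (rule that)
qed

text \<open>The crude bound on \<open>\<parallel>T\<^sup>m\<parallel>\<close> loses only a factor linear in \<open>m\<close>, and normality of \<open>T\<close> gives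
  \<open>\<parallel>T x\<parallel>\<^bsup>2^k\<^esup> \<le> \<parallel>T\<^bsup>2^k\<^esup> x\<parallel>\<close> for unit vectors \<open>x\<close>; taking \<open>2^k\<close>-th roots removes the factor.\<close>

lemma laurent_norm:
  assumes T: "laurent f T" and M: "\<And>z. cmod z = 1 \<Longrightarrow> cmod (f z) \<le> M" and x: "x \<in> Space H"
  shows "hnorm H (T x) \<le> M * hnorm H x"
proof (cases "x = 0")
  case True
  then show ?thesis
    by (simp add: bounded_ops_zero[OF laurent_bounded[OF T]])
next
  case False
  define n where "n = hnorm H x"
  define r where "r = hnorm H (T x) / n"
  have n: "n > 0"
    using False x hnorm_eq_0[of x] hnorm_nonneg[of x] by (simp add: n_def less_le)
  obtain D :: nat where D:
    "\<And>m x. x \<in> Space H \<Longrightarrow> hnorm H ((T ^^ m) x) \<le> (real m * real D + 1) * M ^ m * hnorm H x"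
    using laurent_power_bound[OF T M] by metis
  \<comment> \<open>Repeated squaring: \<open>laurent_normal\<close> is applied not to
    \<open>T\<close> but to its power \<open>P\<close>, again a Laurent polynomial and therefore
    normal.\<close>
  have grow: "r ^ (2 ^ k) * n \<le> hnorm H ((T ^^ (2 ^ k)) x)" for k
  proof (induction k)
    case 0
    then show ?case using n by (simp add: r_def)
  next
    case (Suc k)
    obtain P where P: "laurent (\<lambda>z. f z ^ (2 ^ k)) P" "\<forall>x\<in>Space H. P x = (T ^^ (2 ^ k)) x"
      using laurent_power[OF T] by blast
    have Px: "P x \<in> Space H"
      using laurent_Space[OF P(1) x] .
    have "(r ^ (2 ^ k) * n)\<^sup>2 \<le> (hnorm H (P x))\<^sup>2"
      using Suc P(2) x n by (intro power_mono) (auto simp: r_def laurent_Space[OF T])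
    also have "\<dots> \<le> hnorm H (P (P x)) * n"
      unfolding n_def by (rule laurent_normal[OF P(1) x])
    also have "P (P x) = (T ^^ (2 ^ Suc k)) x"
    proof -
      have "P (P x) = (T ^^ (2 ^ k)) ((T ^^ (2 ^ k)) x)"
        using P(2) Px x by simp
      then show ?thesis
        by (simp add: mult_2 funpow_add)
    qed
    finally have "(r ^ (2 ^ Suc k) * n) * n \<le> hnorm H ((T ^^ (2 ^ Suc k)) x) * n"
      by (simp add: power_mult_distrib power_mult[symmetric] power2_eq_square[of n] mult.commute mult.assoc)
    then show ?case
      using n by (rule mult_right_le_imp_le)
  qed
  have bound: "r ^ (2 ^ k) \<le> (2 ^ k * real D + 1) * M ^ (2 ^ k)" for k
  proof -
    have "r ^ (2 ^ k) * n \<le> ((2 ^ k * real D + 1) * M ^ (2 ^ k)) * n"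
      using grow[of k] D[OF x, of "2 ^ k"] by (simp add: n_def)
    then show ?thesis
      using n by (rule mult_right_le_imp_le)
  qed
  have "cmod (f 1) \<le> M"
    using M[of 1] by simp
  then have M0: "M \<ge> 0"
    using norm_ge_zero[of "f 1"] by linarith
  have "r \<le> M"
  proof (cases "M = 0")
    case True
    then show ?thesis using bound[of 0] by simp
  next
    case False
    with M0 have "M > 0" by simp
    have "(r / M) ^ (2 ^ k) \<le> 2 ^ k * real D + 1" for k
      using bound[of k] \<open>M > 0\<close> by (simp add: power_divide pos_divide_le_eq)
    then have "r / M \<le> 1"
      by (rule base_le_1_of_power_bound) simp
    then show ?thesis
      using \<open>M > 0\<close> by (simp add: pos_divide_le_eq)
  qed
  then show ?thesis
    using n by (simp add: r_def n_def pos_divide_le_eq)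
qed

text \<open>The closure of \<open>laurent\<close>: one polynomial must approximate the symbol
  uniformly and the operator in norm, with the same error. As a relation it obeys the algebraic
  rules before existence or uniqueness is known, and the vectorwise estimate avoids the supremum in
  \<open>op_norm\<close>.\<close>

definition calc :: "(complex \<Rightarrow> complex) \<Rightarrow> ('v \<Rightarrow> 'v) \<Rightarrow> bool" where
  "calc f A \<longleftrightarrow> A \<in> bounded_ops H \<and>
     (\<forall>e>0. \<exists>g T. laurent g T \<and> (\<forall>z\<in>sphere 0 1. cmod (f z - g z) \<le> e) \<and>
        (\<forall>x\<in>Space H. hnorm H (A x - T x) \<le> e * hnorm H x))"

lemma calc_bounded: "calc f A \<Longrightarrow> A \<in> bounded_ops H"
  by (simp add: calc_def)

lemma calc_Space: "calc f A \<Longrightarrow> x \<in> Space H \<Longrightarrow> A x \<in> Space H"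
  using calc_bounded bounded_opsD(1) by blast

lemma calc_obtain:
  assumes "calc f A" "e > 0"
  obtains g T where "laurent g T" "\<And>z. z \<in> sphere 0 1 \<Longrightarrow> cmod (f z - g z) \<le> e"
    "\<And>x. x \<in> Space H \<Longrightarrow> hnorm H (A x - T x) \<le> e * hnorm H x"
  using assms unfolding calc_def by blast

lemma laurent_calc:
  assumes "laurent f T"
  shows "calc f T"
  unfolding calc_def
proof (intro conjI allI impI exI)
  show "T \<in> bounded_ops H" using assms by (rule laurent_bounded)
qed (use assms in auto)

lemma calc_add:
  assumes f: "calc f A" and g: "calc g B"
  shows "calc (\<lambda>z. f z + g z) (op_add H A B)"
  unfolding calc_def
proof (intro conjI allI impI)
  fix e :: real assume "e > 0"
  then have e2: "e / 2 > 0" by simp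
  obtain f' S where f': "laurent f' S" "\<And>z. z \<in> sphere 0 1 \<Longrightarrow> cmod (f z - f' z) \<le> e / 2"
    "\<And>x. x \<in> Space H \<Longrightarrow> hnorm H (A x - S x) \<le> e / 2 * hnorm H x"
    by (rule calc_obtain[OF f e2]) (rule that)
  obtain g' T where g': "laurent g' T" "\<And>z. z \<in> sphere 0 1 \<Longrightarrow> cmod (g z - g' z) \<le> e / 2"
    "\<And>x. x \<in> Space H \<Longrightarrow> hnorm H (B x - T x) \<le> e / 2 * hnorm H x"
    by (rule calc_obtain[OF g e2]) (rule that)
  show "\<exists>h R. laurent h R \<and> (\<forall>z\<in>sphere 0 1. cmod (f z + g z - h z) \<le> e) \<and>
          (\<forall>x\<in>Space H. hnorm H (op_add H A B x - R x) \<le> e * hnorm H x)"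
  proof (intro exI conjI ballI)
    show "laurent (\<lambda>z. f' z + g' z) (op_add H S T)"
      using f'(1) g'(1) by (rule laurent.add)
  next
    fix z :: complex assume z: "z \<in> sphere 0 1"
    have eq: "f z + g z - (f' z + g' z) = (f z - f' z) + (g z - g' z)" by simp
    show "cmod (f z + g z - (f' z + g' z)) \<le> e"
      unfolding eq
      using norm_triangle_ineq[of "f z - f' z" "g z - g' z"] f'(2)[OF z] g'(2)[OF z] by linarith
  next
    fix x assume x: "x \<in> Space H"
    have sp: "A x \<in> Space H" "B x \<in> Space H" "S x \<in> Space H" "T x \<in> Space H"
      using x f g f'(1) g'(1) calc_Space laurent_Space by auto
    have "op_add H A B x - op_add H S T x = (A x - S x) + (B x - T x)"
      using x by (simp add: op_add_def)
    then have "hnorm H (op_add H A B x - op_add H S T x) \<le> hnorm H (A x - S x) + hnorm H (B x - T x)"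
      using hnorm_triangle[of "A x - S x" "B x - T x"] sp by simp
    also have "\<dots> \<le> e / 2 * hnorm H x + e / 2 * hnorm H x"
      using f'(3)[OF x] g'(3)[OF x] by (rule add_mono)
    finally show "hnorm H (op_add H A B x - op_add H S T x) \<le> e * hnorm H x"
      by simp
  qed
qed (use calc_bounded f g in simp)

lemma calc_scl:
  assumes f: "calc f A"
  shows "calc (\<lambda>z. c * f z) (op_scl H c A)"
  unfolding calc_def
proof (intro conjI allI impI)
  fix e :: real assume "e > 0"
  define d where "d = e / (cmod c + 1)"
  have "cmod c + 1 > 0" by (smt (verit) norm_ge_zero)
  then have d: "d > 0" and cd: "cmod c * d \<le> e"
    using \<open>e > 0\<close> by (simp_all add: d_def pos_divide_le_eq mult_right_mono distrib_left mult.commute)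
  obtain f' S where f': "laurent f' S" "\<And>z. z \<in> sphere 0 1 \<Longrightarrow> cmod (f z - f' z) \<le> d"
    "\<And>x. x \<in> Space H \<Longrightarrow> hnorm H (A x - S x) \<le> d * hnorm H x"
    by (rule calc_obtain[OF f d]) (rule that)
  show "\<exists>h R. laurent h R \<and> (\<forall>z\<in>sphere 0 1. cmod (c * f z - h z) \<le> e) \<and>
          (\<forall>x\<in>Space H. hnorm H (op_scl H c A x - R x) \<le> e * hnorm H x)"
  proof (intro exI conjI ballI)
    show "laurent (\<lambda>z. c * f' z) (op_scl H c S)"
      using f'(1) by (rule laurent.scl)
  next
    fix z :: complex assume z: "z \<in> sphere 0 1"
    have "cmod (c * f z - c * f' z) = cmod c * cmod (f z - f' z)"
      by (simp add: norm_mult[symmetric] right_diff_distrib)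
    also have "\<dots> \<le> cmod c * d"
      using f'(2)[OF z] by (intro mult_left_mono) auto
    finally show "cmod (c * f z - c * f' z) \<le> e"
      using cd by linarith
  next
    fix x assume x: "x \<in> Space H"
    have sp: "A x \<in> Space H" "S x \<in> Space H"
      using x f f'(1) calc_Space laurent_Space by auto
    have "hnorm H (op_scl H c A x - op_scl H c S x) = cmod c * hnorm H (A x - S x)"
      using x sp hnorm_scl[of "A x - S x" c] by (simp add: op_scl_def scale_right_diff_distrib)
    also have "\<dots> \<le> cmod c * (d * hnorm H x)"
      using f'(3)[OF x] by (intro mult_left_mono) auto
    also have "\<dots> \<le> e * hnorm H x"
      using mult_right_mono[OF cd hnorm_nonneg[OF x]] by (simp add: mult.assoc)
    finally show "hnorm H (op_scl H c A x - op_scl H c S x) \<le> e * hnorm H x" .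
  qed
qed (use calc_bounded f in simp)

lemma calc_diff:
  assumes f: "calc f A" and g: "calc g B"
  shows "calc (\<lambda>z. f z - g z) (op_diff H A B)"
  using calc_add[OF f calc_scl[OF g, of "-1"]] calc_bounded[OF f] calc_bounded[OF g]
  by (simp add: op_diff_eq)

lemma calc_norm:
  assumes f: "calc f A" and M: "\<And>z. z \<in> sphere 0 1 \<Longrightarrow> cmod (f z) \<le> M" and x: "x \<in> Space H"
  shows "hnorm H (A x) \<le> M * hnorm H x"
proof (rule field_le_epsilon)
  fix e' :: real assume "e' > 0"
  \<comment> \<open>The error enters twice, once through the symbol and once through the operator;
    the added \<open>1\<close> covers \<open>hnorm H x = 0\<close>.\<close>
  define e where "e = e' / (2 * (hnorm H x + 1))"
  have pos: "2 * (hnorm H x + 1) > 0" using hnorm_nonneg[OF x] by (simp add: add_nonneg_pos)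
  then have e: "e > 0" using \<open>e' > 0\<close> by (simp add: e_def)
  have "e * (2 * (hnorm H x + 1)) = e'"
    using pos by (simp add: e_def)
  then have small: "2 * e * hnorm H x \<le> e'"
    using e by (simp add: algebra_simps)
  obtain g T where g: "laurent g T" "\<And>z. z \<in> sphere 0 1 \<Longrightarrow> cmod (f z - g z) \<le> e"
    "\<And>x. x \<in> Space H \<Longrightarrow> hnorm H (A x - T x) \<le> e * hnorm H x"
    by (rule calc_obtain[OF f e]) (rule that)
  have "hnorm H (T x) \<le> (M + e) * hnorm H x"
  proof (rule laurent_norm[OF g(1) _ x])
    fix z :: complex assume "cmod z = 1"
    then have z: "z \<in> sphere 0 1" by simp
    show "cmod (g z) \<le> M + e"
      using M[OF z] g(2)[OF z] norm_triangle_ineq2[of "g z" "f z"] norm_minus_commute[of "f z" "g z"] by linarith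
  qed
  moreover have "hnorm H (A x) \<le> hnorm H (A x - T x) + hnorm H (T x)"
    using calc_Space[OF f x] laurent_Space[OF g(1) x] by (rule hnorm_le_diff)
  ultimately show "hnorm H (A x) \<le> M * hnorm H x + e'"
    using g(3)[OF x] small by (simp add: algebra_simps)
qed

text \<open>Turns a uniform estimate of symbols into one of operators. Uniqueness, the adjoint rule,
  the Cauchy property of approximants and the matrix entries of the shift all go through it.\<close>

lemma calc_dist:
  assumes "calc f A" "calc g B" "\<And>z. z \<in> sphere 0 1 \<Longrightarrow> cmod (f z - g z) \<le> M" "x \<in> Space H"
  shows "hnorm H (A x - B x) \<le> M * hnorm H x"
  using calc_norm[OF calc_diff[OF assms(1,2)] assms(3,4)] assms(4) by (simp add: op_diff_def)

lemma calc_unique: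
  assumes f: "calc f A" and g: "calc g B" and eq: "\<And>z. z \<in> sphere 0 1 \<Longrightarrow> f z = g z"
  shows "A = B"
proof (rule bounded_ops_eqI[OF calc_bounded[OF f] calc_bounded[OF g]])
  fix x assume x: "x \<in> Space H"
  have sp: "A x - B x \<in> Space H"
    using x f g calc_Space by simp
  have "hnorm H (A x - B x) \<le> 0 * hnorm H x"
    by (rule calc_dist[OF f g _ x]) (simp add: eq)
  then have "hnorm H (A x - B x) = 0"
    using hnorm_nonneg[OF sp] by linarith
  then show "A x = B x"
    using hnorm_eq_0[OF sp] by simp
qed

text \<open>\<open>calc\<close> does not presuppose continuity of \<open>f\<close>, but a Laurent
  polynomial within distance \<open>1\<close> is continuous on the compact circle.\<close>

lemma calc_fun_bounded:
  assumes f: "calc f A"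
  obtains M where "M \<ge> 0" "\<And>z. z \<in> sphere 0 1 \<Longrightarrow> cmod (f z) \<le> M"
proof -
  obtain g T where g: "laurent g T" "\<And>z. z \<in> sphere 0 1 \<Longrightarrow> cmod (f z - g z) \<le> 1"
    using calc_obtain[OF f zero_less_one] by metis
  have "compact (g ` sphere 0 1)"
    using laurent_continuous[OF g(1)] by (intro compact_continuous_image compact_sphere)
  then obtain B where B: "\<And>z. z \<in> sphere 0 1 \<Longrightarrow> cmod (g z) \<le> B"
    using compact_imp_bounded bounded_iff by (metis image_eqI)
  have "cmod (f z) \<le> \<bar>B\<bar> + 1" if "z \<in> sphere 0 1" for z
    using B[OF that] g(2)[OF that] norm_triangle_ineq2[of "f z" "g z"] by linarith
  then show ?thesis
    by (rule that[of "\<bar>B\<bar> + 1", rotated]) auto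
qed

lemma calc_mult:
  assumes f: "calc f A" and g: "calc g B"
  shows "calc (\<lambda>z. f z * g z) (compose (Space H) A B)"
  unfolding calc_def
proof (intro conjI allI impI)
  fix e :: real assume "e > 0"
  obtain F where F: "F \<ge> 0" "\<And>z. z \<in> sphere 0 1 \<Longrightarrow> cmod (f z) \<le> F"
    by (rule calc_fun_bounded[OF f]) (rule that)
  obtain G where G: "G \<ge> 0" "\<And>z. z \<in> sphere 0 1 \<Longrightarrow> cmod (g z) \<le> G"
    by (rule calc_fun_bounded[OF g]) (rule that)
  define K where "K = F + G + 1"
  have K: "K > 0" using F G by (simp add: K_def)
  \<comment> \<open>With \<open>d \<le> 1\<close> the approximant of \<open>g\<close> stays below
    \<open>G + 1\<close>, and the two errors of the product, \<open>F * d\<close> and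
    \<open>d * (G + 1)\<close>, add up to \<open>d * K\<close>.\<close>
  define d where "d = min 1 (e / K)"
  have d: "d > 0" "d \<le> 1" and dK: "d * K \<le> e"
    using \<open>e > 0\<close> K by (auto simp: d_def min_def pos_le_divide_eq mult.commute)
  obtain f' S where f': "laurent f' S" "\<And>z. z \<in> sphere 0 1 \<Longrightarrow> cmod (f z - f' z) \<le> d"
    "\<And>x. x \<in> Space H \<Longrightarrow> hnorm H (A x - S x) \<le> d * hnorm H x"
    by (rule calc_obtain[OF f d(1)]) (rule that)
  obtain g' T where g': "laurent g' T" "\<And>z. z \<in> sphere 0 1 \<Longrightarrow> cmod (g z - g' z) \<le> d"
    "\<And>x. x \<in> Space H \<Longrightarrow> hnorm H (B x - T x) \<le> d * hnorm H x"
    by (rule calc_obtain[OF g d(1)]) (rule that)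
  have g'_le: "cmod (g' z) \<le> G + 1" if z: "z \<in> sphere 0 1" for z
    using G(2)[OF z] g'(2)[OF z] d(2) norm_triangle_ineq2[of "g' z" "g z"]
      norm_minus_commute[of "g z" "g' z"] by linarith
  show "\<exists>h R. laurent h R \<and> (\<forall>z\<in>sphere 0 1. cmod (f z * g z - h z) \<le> e) \<and>
          (\<forall>x\<in>Space H. hnorm H (compose (Space H) A B x - R x) \<le> e * hnorm H x)"
  proof (intro exI conjI ballI)
    show "laurent (\<lambda>z. f' z * g' z) (compose (Space H) S T)"
      using f'(1) g'(1) by (rule laurent.mult)
  next
    fix z :: complex assume z: "z \<in> sphere 0 1"
    have "f z * g z - f' z * g' z = f z * (g z - g' z) + (f z - f' z) * g' z"
      by (simp add: algebra_simps)
    then have "cmod (f z * g z - f' z * g' z) \<le> cmod (f z) * cmod (g z - g' z) + cmod (f z - f' z) * cmod (g' z)"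
      by (metis norm_mult norm_triangle_ineq)
    also have "\<dots> \<le> F * d + d * (G + 1)"
      using F G d f'(2)[OF z] g'(2)[OF z] g'_le[OF z] z by (intro add_mono mult_mono) auto
    also have "\<dots> = d * K" by (simp add: K_def algebra_simps)
    finally show "cmod (f z * g z - f' z * g' z) \<le> e"
      using dK by linarith
  next
    fix x assume x: "x \<in> Space H"
    have sp: "B x \<in> Space H" "T x \<in> Space H" "A (T x) \<in> Space H" "S (T x) \<in> Space H" "A (B x) \<in> Space H"
      using x f g f'(1) g'(1) calc_Space laurent_Space by auto
    have "hnorm H (A (B x) - S (T x)) \<le> hnorm H (A (B x) - A (T x)) + hnorm H (A (T x) - S (T x))"
      using sp by (intro hnorm_diff_triangle)
    also have "A (B x) - A (T x) = A (B x - T x)"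
      using sp by (simp add: bounded_ops_diff[OF calc_bounded[OF f]])
    also have "hnorm H (A (B x - T x)) \<le> F * hnorm H (B x - T x)"
      using sp by (intro calc_norm[OF f F(2)]) auto
    also have "\<dots> \<le> F * (d * hnorm H x)"
      using g'(3)[OF x] F(1) by (rule mult_left_mono)
    also have "hnorm H (A (T x) - S (T x)) \<le> d * hnorm H (T x)"
      using f'(3) sp by blast
    also have "\<dots> \<le> d * ((G + 1) * hnorm H x)"
      using d x by (intro mult_left_mono laurent_norm[OF g'(1)] g'_le) auto
    also have "F * (d * hnorm H x) + d * ((G + 1) * hnorm H x) = (d * K) * hnorm H x"
      by (simp add: K_def algebra_simps)
    also have "\<dots> \<le> e * hnorm H x"
      using dK x by (intro mult_right_mono) auto
    finally show "hnorm H (compose (Space H) A B x - compose (Space H) S T x) \<le> e * hnorm H x"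
      using x by (simp add: compose_def)
  qed
qed (use calc_bounded f g in simp)

text \<open>The adjoint \<open>T'\<close> of an approximant of \<open>A\<close> has the conjugate
  symbol, so \<open>calc_dist\<close> places it near \<open>B\<close>; the defect of the adjoint
  relation is then smaller than any \<open>e'\<close>.\<close>

lemma calc_adjoint:
  assumes f: "calc f A" and g: "calc (\<lambda>z. cnj (f z)) B"
  shows "is_adjoint H A B"
  unfolding is_adjoint_def
proof (intro ballI)
  fix x y assume x: "x \<in> Space H" and y: "y \<in> Space H"
  define K where "K = hnorm H x * hnorm H y"
  have K: "K \<ge> 0" using x y by (simp add: K_def)
  have "cmod (ip H (A x) y - ip H x (B y)) \<le> 0 + e'" if "e' > 0" for e' :: real
  proof -
    define e where "e = e' / (2 * K + 1)"
    have "2 * K + 1 > 0" using K by linarith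
    then have e: "e > 0" and "e * (2 * K + 1) = e'"
      using \<open>e' > 0\<close> by (simp_all add: e_def)
    then have small: "2 * e * K \<le> e'"
      by (simp add: algebra_simps)
    obtain f' T where f': "laurent f' T" "\<And>z. z \<in> sphere 0 1 \<Longrightarrow> cmod (f z - f' z) \<le> e"
      "\<And>x. x \<in> Space H \<Longrightarrow> hnorm H (A x - T x) \<le> e * hnorm H x"
      by (rule calc_obtain[OF f e]) (rule that)
    obtain T' where T': "laurent (\<lambda>z. cnj (f' z)) T'" "is_adjoint H T T'"
      using laurent_adjoint[OF f'(1)] by blast
    have sp: "A x \<in> Space H" "T x \<in> Space H" "T' y \<in> Space H" "B y \<in> Space H"
      using x y f g f'(1) T'(1) calc_Space laurent_Space by auto
    have dist: "hnorm H (T' y - B y) \<le> e * hnorm H y"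
    proof (rule calc_dist[OF laurent_calc[OF T'(1)] g _ y])
      fix z :: complex assume z: "z \<in> sphere 0 1"
      show "cmod (cnj (f' z) - cnj (f z)) \<le> e"
        using f'(2)[OF z] by (metis complex_cnj_diff complex_mod_cnj norm_minus_commute)
    qed
    have "ip H (A x) y - ip H x (B y) = ip H (A x - T x) y + ip H x (T' y - B y)"
      using is_adjointD[OF T'(2) x y] sp x y by (simp add: ip_diff_left ip_diff_right)
    then have "cmod (ip H (A x) y - ip H x (B y)) \<le> cmod (ip H (A x - T x) y) + cmod (ip H x (T' y - B y))"
      by (simp add: norm_triangle_ineq)
    also have "\<dots> \<le> hnorm H (A x - T x) * hnorm H y + hnorm H x * hnorm H (T' y - B y)"
      using sp x y by (intro add_mono Cauchy_Schwarz) auto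
    also have "\<dots> \<le> (e * hnorm H x) * hnorm H y + hnorm H x * (e * hnorm H y)"
      using f'(3)[OF x] dist x y by (intro add_mono mult_left_mono mult_right_mono) auto
    also have "\<dots> = 2 * e * K"
      by (simp add: K_def)
    finally show ?thesis using small by linarith
  qed
  then have "cmod (ip H (A x) y - ip H x (B y)) \<le> 0"
    by (rule field_le_epsilon)
  then show "ip H (A x) y = ip H x (B y)" by simp
qed

section \<open>Density and existence\<close>

lemma laurent_real_polynomial:
  assumes "real_polynomial_function p"
  shows "\<exists>T. laurent (\<lambda>z. complex_of_real (p z)) T"
  using assms
proof (induction rule: real_polynomial_function.induct)
  case (linear f)
  interpret f: bounded_linear f by fact
  \<comment> \<open>A real-linear functional on the plane has the form
    \<open>2 * Re (a * z)\<close>; evaluating it at \<open>1\<close> and \<open>\<i>\<close>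
    determines \<open>a\<close>.\<close>
  define a where "a = (complex_of_real (f 1) - \<i> * complex_of_real (f \<i>)) / 2"
  have "complex_of_real (f z) = a * z + cnj a * cnj z" for z
  proof -
    have "f z = f (Re z *\<^sub>R 1 + Im z *\<^sub>R \<i>)"
      by (rule arg_cong[of _ _ f]) (simp add: complex_eq_iff)
    also have "\<dots> = Re z * f 1 + Im z * f \<i>"
      by (simp add: f.add f.scaleR)
    finally show ?thesis
      by (simp add: a_def complex_eq_iff field_simps)
  qed
  then have "(\<lambda>z. complex_of_real (f z)) = (\<lambda>z. a * z + cnj a * cnj z)"
    by (rule ext)
  moreover have "laurent (\<lambda>z. a * z + cnj a * cnj z) (op_add H (op_scl H a U) (op_scl H (cnj a) Us))"
    by (intro laurent.intros)
  ultimately show ?case by metis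
next
  case (const c)
  have "laurent (\<lambda>z. complex_of_real c * 1) (op_scl H (complex_of_real c) (op_id H))"
    by (intro laurent.intros)
  then show ?case by auto
next
  case (add f g)
  then obtain S T where "laurent (\<lambda>z. complex_of_real (f z)) S" "laurent (\<lambda>z. complex_of_real (g z)) T"
    by blast
  then have "laurent (\<lambda>z. complex_of_real (f z) + complex_of_real (g z)) (op_add H S T)"
    by (rule laurent.add)
  then show ?case by auto
next
  case (mult f g)
  then obtain S T where "laurent (\<lambda>z. complex_of_real (f z)) S" "laurent (\<lambda>z. complex_of_real (g z)) T"
    by blast
  then have "laurent (\<lambda>z. complex_of_real (f z) * complex_of_real (g z)) (compose (Space H) S T)"
    by (rule laurent.mult)
  then show ?case by auto
qed

lemma laurent_dense:
  assumes f: "continuous_on (sphere 0 1) f" and "e > 0"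
  shows "\<exists>g T. laurent g T \<and> (\<forall>z\<in>sphere 0 1. cmod (f z - g z) \<le> e)"
proof -
  have e2: "e / 2 > 0" using \<open>e > 0\<close> by simp
  have cont: "continuous_on (sphere 0 1) (\<lambda>z. Re (f z))" "continuous_on (sphere 0 1) (\<lambda>z. Im (f z))"
    using f by (auto intro!: continuous_intros)
  obtain p where p: "real_polynomial_function p" "\<And>z. z \<in> sphere 0 1 \<Longrightarrow> \<bar>Re (f z) - p z\<bar> < e / 2"
    using Stone_Weierstrass_real_polynomial_function[OF compact_sphere cont(1) e2] by blast
  obtain q where q: "real_polynomial_function q" "\<And>z. z \<in> sphere 0 1 \<Longrightarrow> \<bar>Im (f z) - q z\<bar> < e / 2"
    using Stone_Weierstrass_real_polynomial_function[OF compact_sphere cont(2) e2] by blast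
  obtain S T where S: "laurent (\<lambda>z. complex_of_real (p z)) S" and T: "laurent (\<lambda>z. complex_of_real (q z)) T"
    using laurent_real_polynomial p(1) q(1) by blast
  show ?thesis
  proof (intro exI conjI ballI)
    show "laurent (\<lambda>z. complex_of_real (p z) + \<i> * complex_of_real (q z)) (op_add H S (op_scl H \<i> T))"
      by (intro laurent.add laurent.scl S T)
    fix z :: complex assume z: "z \<in> sphere 0 1"
    show "cmod (f z - (complex_of_real (p z) + \<i> * complex_of_real (q z))) \<le> e"
      using cmod_le[of "f z - (complex_of_real (p z) + \<i> * complex_of_real (q z))"] p(2)[OF z] q(2)[OF z]
      by simp
  qed
qed

text \<open>At each vector the approximants form a Cauchy sequence. Carrying the explicit rate
  \<open>e n * hnorm H x\<close> to the limit gives linearity of the limit operator and an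
  approximation uniform in the vector at once.\<close>

lemma calc_exists:
  assumes f: "continuous_on (sphere 0 1) f"
  shows "\<exists>A. calc f A"
proof -
  define e where "e n = inverse (real (Suc n))" for n
  have e: "e n > 0" for n by (simp add: e_def)
  have e0: "e \<longlonglongrightarrow> 0" unfolding e_def by (rule LIMSEQ_inverse_real_of_nat)
  have "\<forall>n. \<exists>g T. laurent g T \<and> (\<forall>z\<in>sphere 0 1. cmod (f z - g z) \<le> e n)"
    using laurent_dense[OF f e] by blast
  then obtain g T where gT: "\<And>n. laurent (g n) (T n)"
      "\<And>n z. z \<in> sphere 0 1 \<Longrightarrow> cmod (f z - g n z) \<le> e n"
    by metis
  have T_Space: "T n x \<in> Space H" if "x \<in> Space H" for n x
    using laurent_Space[OF gT(1) that] .
  have dist: "hnorm H (T m x - T n x) \<le> (e m + e n) * hnorm H x" if x: "x \<in> Space H" for m n x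
  proof (rule calc_dist[OF laurent_calc[OF gT(1)] laurent_calc[OF gT(1)] _ x])
    fix z :: complex assume z: "z \<in> sphere 0 1"
    show "cmod (g m z - g n z) \<le> e m + e n"
      using gT(2)[OF z, of m] gT(2)[OF z, of n] norm_triangle_ineq4[of "f z - g n z" "f z - g m z"] by simp
  qed
  have "\<exists>y\<in>Space H. \<forall>n. hnorm H (T n x - y) \<le> e n * hnorm H x" if x: "x \<in> Space H" for x
  proof -
    have "\<exists>N. \<forall>m\<ge>N. \<forall>n\<ge>N. hnorm H (T m x - T n x) < d" if d: "d > 0" for d
    proof -
      have "(\<lambda>n. e n * (2 * hnorm H x)) \<longlonglongrightarrow> 0"
        using tendsto_mult_left_zero[OF e0] by simp
      then have "eventually (\<lambda>n. e n * (2 * hnorm H x) < d) sequentially"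
        using d by (rule order_tendstoD)
      then obtain N where N: "e N * (2 * hnorm H x) < d"
        by (auto simp: eventually_sequentially)
      show ?thesis
      proof (intro exI allI impI)
        fix m n assume mn: "N \<le> m" "N \<le> n"
        then have "e m + e n \<le> 2 * e N"
          using le_imp_inverse_le[of "real (Suc N)" "real (Suc m)"]
            le_imp_inverse_le[of "real (Suc N)" "real (Suc n)"] unfolding e_def by linarith
        then have "(e m + e n) * hnorm H x \<le> (2 * e N) * hnorm H x"
          using x by (intro mult_right_mono) auto
        then show "hnorm H (T m x - T n x) < d"
          using dist[OF x, of m n] N by (simp add: mult_ac)
      qed
    qed
    then obtain y where y: "y \<in> Space H" "(\<lambda>n. hnorm H (T n x - y)) \<longlonglongrightarrow> 0"
      using complete[of "\<lambda>n. T n x"] T_Space[OF x] by blast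
    have "hnorm H (T n x - y) \<le> e n * hnorm H x" for n
    proof -
      \<comment> \<open>\<open>n\<close> stays fixed and \<open>m\<close> tends to infinity in the
        triangle inequality through \<open>T m x\<close>.\<close>
      have "(\<lambda>m. (e n + e m) * hnorm H x + hnorm H (T m x - y)) \<longlonglongrightarrow> (e n + 0) * hnorm H x + 0"
        by (intro tendsto_intros e0 y(2))
      then have "hnorm H (T n x - y) \<le> (e n + 0) * hnorm H x + 0"
      proof (rule tendsto_lowerbound)
        show "\<forall>\<^sub>F m in sequentially. hnorm H (T n x - y) \<le> (e n + e m) * hnorm H x + hnorm H (T m x - y)"
        proof (rule always_eventually, intro allI)
          fix m
          show "hnorm H (T n x - y) \<le> (e n + e m) * hnorm H x + hnorm H (T m x - y)"
            using hnorm_diff_triangle[OF T_Space[OF x] T_Space[OF x] y(1), of n m] dist[OF x, of n m]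
            by linarith
        qed
      qed simp
      then show ?thesis by simp
    qed
    then show ?thesis using y(1) by blast
  qed
  then obtain A' where A': "\<And>x. x \<in> Space H \<Longrightarrow> A' x \<in> Space H"
      "\<And>x n. x \<in> Space H \<Longrightarrow> hnorm H (T n x - A' x) \<le> e n * hnorm H x"
    by metis
  define A where "A = (\<lambda>x\<in>Space H. A' x)"
  have A_Space: "A x \<in> Space H" if "x \<in> Space H" for x
    using A'(1) that by (simp add: A_def)
  have A_T: "hnorm H (A x - T n x) \<le> e n * hnorm H x" if "x \<in> Space H" for x n
    using A'[OF that] that hnorm_minus_commute[OF A'(1)[OF that] T_Space[OF that]] by (simp add: A_def)
  note T_lin = bounded_opsD[OF laurent_bounded[OF gT(1)]]
  obtain K where K: "\<forall>x\<in>Space H. hnorm H (T 0 x) \<le> K * hnorm H x"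
    using bounded_ops_bound[OF laurent_bounded[OF gT(1)]] by blast
  have "A \<in> bounded_ops H"
  proof (rule bounded_opsI)
    show "A x \<in> Space H" if "x \<in> Space H" for x by (rule A_Space[OF that])
    show "A \<in> extensional (Space H)" by (simp add: A_def)
  next
    fix x y assume x: "x \<in> Space H" and y: "y \<in> Space H"
    let ?d = "A (x + y) - (A x + A y)"
    have "hnorm H ?d \<le> e n * (hnorm H (x + y) + (hnorm H x + hnorm H y))" for n
    proof -
      have eq: "?d = (A (x + y) - T n (x + y)) - ((A x - T n x) + (A y - T n y))"
        using T_lin(2)[OF x y, of n] by (simp add: algebra_simps)
      have "hnorm H ?d \<le> hnorm H (A (x + y) - T n (x + y)) + hnorm H ((A x - T n x) + (A y - T n y))"
        unfolding eq using x y A_Space T_Space by (intro hnorm_diff_le) auto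
      also have "hnorm H ((A x - T n x) + (A y - T n y)) \<le> hnorm H (A x - T n x) + hnorm H (A y - T n y)"
        using x y A_Space T_Space by (intro hnorm_triangle) auto
      finally show ?thesis
        using A_T[OF x, of n] A_T[OF y, of n] A_T[OF add_Space[OF x y], of n]
        by (simp add: distrib_left)
    qed
    then have "?d = 0"
      using x y A_Space by (intro inverse_Suc_bound_imp_0) (auto simp: e_def)
    then show "A (x + y) = A x + A y" by simp
  next
    fix c x assume x: "x \<in> Space H"
    let ?d = "A (scl H c x) - scl H c (A x)"
    have "hnorm H ?d \<le> e n * (hnorm H (scl H c x) + cmod c * hnorm H x)" for n
    proof -
      have eq: "?d = (A (scl H c x) - T n (scl H c x)) - scl H c (A x - T n x)"
        using T_lin(3)[OF x, of n c] by (simp add: scale_right_diff_distrib)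
      have "hnorm H ?d \<le> hnorm H (A (scl H c x) - T n (scl H c x)) + hnorm H (scl H c (A x - T n x))"
        unfolding eq using x A_Space T_Space by (intro hnorm_diff_le) auto
      also have "hnorm H (scl H c (A x - T n x)) \<le> cmod c * (e n * hnorm H x)"
        using x A_Space T_Space A_T[OF x, of n] by (simp add: hnorm_scl mult_left_mono)
      finally show ?thesis
        using A_T[OF scl_Space[OF x], of c n]
        by (simp add: distrib_left mult_ac)
    qed
    then have "?d = 0"
      using x A_Space by (intro inverse_Suc_bound_imp_0) (auto simp: e_def)
    then show "A (scl H c x) = scl H c (A x)" by simp
  next
    fix x assume x: "x \<in> Space H"
    have "hnorm H (A x) \<le> hnorm H (A x - T 0 x) + hnorm H (T 0 x)"
      by (rule hnorm_le_diff[OF A_Space[OF x] T_Space[OF x]])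
    also have "\<dots> \<le> e 0 * hnorm H x + K * hnorm H x"
      using A_T[OF x, of 0] K x by (intro add_mono) auto
    finally show "hnorm H (A x) \<le> (e 0 + K) * hnorm H x"
      by (simp add: distrib_right)
  qed
  then have "calc f A"
    unfolding calc_def
  proof (intro conjI allI impI)
    fix d :: real assume "d > 0"
    then obtain n where n: "e n < d"
      using reals_Archimedean e_def by metis
    show "\<exists>g T. laurent g T \<and> (\<forall>z\<in>sphere 0 1. cmod (f z - g z) \<le> d) \<and>
            (\<forall>x\<in>Space H. hnorm H (A x - T x) \<le> d * hnorm H x)"
    proof (intro exI conjI ballI)
      show "laurent (g n) (T n)" by (rule gT(1))
      show "cmod (f z - g n z) \<le> d" if "z \<in> sphere 0 1" for z
        using gT(2)[OF that, of n] n by linarith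
      show "hnorm H (A x - T n x) \<le> d * hnorm H x" if "x \<in> Space H" for x
        using A_T[OF that, of n] mult_right_mono[OF less_imp_le[OF n] hnorm_nonneg[OF that]] by linarith
    qed
  qed
  then show ?thesis by (rule exI[of _ A])
qed

section \<open>Existence and uniqueness of the functional calculus\<close>

lemma functional_calculus_exists:
  "\<exists>\<Phi>. is_functional_calculus H U \<Phi> \<and> (\<forall>f. continuous_on (sphere 0 1) f \<longrightarrow> calc f (\<Phi> f))"
proof -
  \<comment> \<open>A mere choice for each symbol suffices: \<open>calc\<close> is closed under all
    the operations, and uniqueness turns closure into equations for the chosen operators.\<close>
  obtain \<Phi> where \<Phi>: "\<And>f. continuous_on (sphere 0 1) f \<Longrightarrow> calc f (\<Phi> f)"
    using calc_exists by metis
  have eq: "\<Phi> f = A" if "calc f A" "continuous_on (sphere 0 1) f" for f A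
    using calc_unique[OF \<Phi>[OF that(2)] that(1)] by simp
  have "is_functional_calculus H U \<Phi>"
    unfolding is_functional_calculus_def
  proof (intro conjI allI impI)
    fix f :: "complex \<Rightarrow> complex" assume f: "continuous_on (sphere 0 1) f"
    note \<Phi>f = \<Phi>[OF f]
    show "\<Phi> f \<in> bounded_ops H"
      using \<Phi>f by (rule calc_bounded)
    show "\<Phi> (\<lambda>z. c * f z) = op_scl H c (\<Phi> f)" for c
      by (intro eq calc_scl \<Phi>f continuous_intros f)
    show "is_adjoint H (\<Phi> f) (\<Phi> (\<lambda>z. cnj (f z)))"
      by (intro calc_adjoint[of f] \<Phi> continuous_intros f)
    fix g :: "complex \<Rightarrow> complex" assume g: "continuous_on (sphere 0 1) g"
    note \<Phi>g = \<Phi>[OF g]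
    show "\<Phi> (\<lambda>z. f z + g z) = op_add H (\<Phi> f) (\<Phi> g)"
      by (intro eq calc_add \<Phi>f \<Phi>g continuous_intros f g)
    show "\<Phi> (\<lambda>z. f z * g z) = compose (Space H) (\<Phi> f) (\<Phi> g)"
      by (intro eq calc_mult \<Phi>f \<Phi>g continuous_intros f g)
    show "\<Phi> f = \<Phi> g" if "\<forall>z\<in>sphere 0 1. f z = g z"
      using calc_unique[OF \<Phi>f \<Phi>g] that by blast
  next
    show "\<Phi> (\<lambda>z. 1) = op_id H"
      by (intro eq laurent_calc laurent.one continuous_intros)
    show "\<Phi> (\<lambda>z. z) = U"
      by (intro eq laurent_calc laurent.ident continuous_intros)
  qed
  with \<Phi> show ?thesis by blast
qed

text \<open>The homomorphism laws fix every value generated from \<open>1\<close> and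
  \<open>z\<close>; at \<open>cnj z\<close> the value is an adjoint of \<open>U\<close>, which is
  unique.\<close>

lemma functional_calculus_laurent:
  assumes \<Phi>: "is_functional_calculus H U \<Phi>" and "laurent f T"
  shows "\<Phi> f = T"
  using assms(2)
proof (induction rule: laurent.induct)
  case one
  show ?case using \<Phi> by (simp add: is_functional_calculus_def)
next
  case ident
  show ?case using \<Phi> by (simp add: is_functional_calculus_def)
next
  case conj
  have id: "continuous_on (sphere 0 1) (\<lambda>z::complex. z)" and cnj: "continuous_on (sphere 0 1) (\<lambda>z. cnj z)"
    by (intro continuous_intros)+
  have "is_adjoint H (\<Phi> (\<lambda>z. z)) (\<Phi> (\<lambda>z. cnj z))" "\<Phi> (\<lambda>z. z) = U" "\<Phi> (\<lambda>z. cnj z) \<in> bounded_ops H"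
    using \<Phi> id cnj unfolding is_functional_calculus_def by blast+
  then show ?case
    using is_adjoint_unique[OF _ U_adjoint] by simp
next
  case (add f S g T)
  then show ?case
    using \<Phi> laurent_continuous unfolding is_functional_calculus_def by metis
next
  case (scl f T c)
  then show ?case
    using \<Phi> laurent_continuous unfolding is_functional_calculus_def by metis
next
  case (mult f S g T)
  then show ?case
    using \<Phi> laurent_continuous unfolding is_functional_calculus_def by metis
qed

end

text \<open>Contractivity comes from writing \<open>M\<^sup>2 - \<bar>f\<bar>\<^sup>2\<close> as a square.\<close>

lemma (in hilbert_space) functional_calculus_norm:
  assumes \<Phi>: "is_functional_calculus H U \<Phi>" and f: "continuous_on (sphere 0 1) f"
    and M: "\<And>z. z \<in> sphere 0 1 \<Longrightarrow> cmod (f z) \<le> M" and x: "x \<in> Space H"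
  shows "hnorm H (\<Phi> f x) \<le> M * hnorm H x"
proof (rule power2_le_imp_le)
  have M0: "M \<ge> 0"
    using M[of 1] norm_ge_zero[of "f 1"] by (simp del: norm_ge_zero)
  \<comment> \<open>On the circle the squared moduli of \<open>f\<close> and \<open>g\<close> add up
    to \<open>M\<^sup>2\<close>, so the squared norms of \<open>\<Phi> f x\<close> and
    \<open>\<Phi> g x\<close> add up to \<open>M\<^sup>2 * (hnorm H x)\<^sup>2\<close>. Off the
    circle the radicand may be negative, but the values there are irrelevant.\<close>
  define g where "g z = complex_of_real (sqrt (M\<^sup>2 - (cmod (f z))\<^sup>2))" for z
  have g: "continuous_on (sphere 0 1) g"
    unfolding g_def by (intro continuous_intros f)
  have bounded: "\<Phi> k \<in> bounded_ops H" and adj: "is_adjoint H (\<Phi> k) (\<Phi> (\<lambda>z. cnj (k z)))"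
    and scl: "\<Phi> (\<lambda>z. c * k z) = op_scl H c (\<Phi> k)"
    if "continuous_on (sphere 0 1) k" for k c
    using \<Phi> that unfolding is_functional_calculus_def by blast+
  have mult: "\<Phi> (\<lambda>z. k z * l z) = compose (Space H) (\<Phi> k) (\<Phi> l)"
    and add: "\<Phi> (\<lambda>z. k z + l z) = op_add H (\<Phi> k) (\<Phi> l)"
    and cong: "(\<forall>z\<in>sphere 0 1. k z = l z) \<Longrightarrow> \<Phi> k = \<Phi> l"
    if "continuous_on (sphere 0 1) k" "continuous_on (sphere 0 1) l" for k l
    using \<Phi> that unfolding is_functional_calculus_def by blast+
  have one: "\<Phi> (\<lambda>z. 1) = op_id H"
    using \<Phi> unfolding is_functional_calculus_def by blast
  have cnj: "continuous_on (sphere 0 1) (\<lambda>z. cnj (k z))" if "continuous_on (sphere 0 1) k" for k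
    using that by (intro continuous_intros)
  have sq: "ip H (\<Phi> (\<lambda>z. cnj (k z) * k z) x) x = complex_of_real ((hnorm H (\<Phi> k x))\<^sup>2)"
    if k: "continuous_on (sphere 0 1) k" for k
  proof -
    have kx: "\<Phi> k x \<in> Space H"
      using bounded_opsD(1)[OF bounded[OF k] x] .
    have "ip H (\<Phi> (\<lambda>z. cnj (k z) * k z) x) x = ip H (\<Phi> (\<lambda>z. cnj (k z)) (\<Phi> k x)) x"
      using x by (simp add: mult[OF cnj[OF k] k] compose_def)
    also have "\<dots> = ip H (\<Phi> k x) (\<Phi> k x)"
      using is_adjointD[OF adj[OF cnj[OF k]] kx x] by simp
    finally show ?thesis
      by (simp add: ip_eq_hnorm[OF kx])
  qed
  have conts: "continuous_on (sphere 0 1) (\<lambda>z. cnj (f z) * f z)" "continuous_on (sphere 0 1) (\<lambda>z. cnj (g z) * g z)"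
    by (intro continuous_intros f g)+
  have "cnj (f z) * f z + cnj (g z) * g z = complex_of_real (M\<^sup>2) * 1" if "z \<in> sphere 0 1" for z
  proof -
    have "(cmod (f z))\<^sup>2 \<le> M\<^sup>2"
      using M[OF that] by (intro power_mono) auto
    then have "cnj (g z) * g z = complex_of_real (M\<^sup>2 - (cmod (f z))\<^sup>2)"
      by (simp add: g_def flip: of_real_mult)
    moreover have "cnj (f z) * f z = complex_of_real ((cmod (f z))\<^sup>2)"
      by (simp only: complex_norm_square mult.commute)
    ultimately show ?thesis by simp
  qed
  then have "\<Phi> (\<lambda>z. cnj (f z) * f z + cnj (g z) * g z) = \<Phi> (\<lambda>z. complex_of_real (M\<^sup>2) * 1)"
    by (intro cong continuous_intros f g) auto
  also have "\<dots> = op_scl H (complex_of_real (M\<^sup>2)) (op_id H)"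
    by (subst scl) (auto simp: one)
  finally have "op_add H (\<Phi> (\<lambda>z. cnj (f z) * f z)) (\<Phi> (\<lambda>z. cnj (g z) * g z)) x = scl H (complex_of_real (M\<^sup>2)) x"
    using x by (simp add: add[OF conts] op_scl_def op_id_def)
  then have "ip H (\<Phi> (\<lambda>z. cnj (f z) * f z) x + \<Phi> (\<lambda>z. cnj (g z) * g z) x) x = complex_of_real (M\<^sup>2) * ip H x x"
    using x by (simp add: op_add_def ip_scl_left)
  then have "complex_of_real ((hnorm H (\<Phi> f x))\<^sup>2) + complex_of_real ((hnorm H (\<Phi> g x))\<^sup>2) = complex_of_real (M\<^sup>2 * (hnorm H x)\<^sup>2)"
    using x bounded_opsD(1)[OF bounded[OF conts(1)] x] bounded_opsD(1)[OF bounded[OF conts(2)] x]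
    by (simp add: ip_add_left sq[OF f] sq[OF g] ip_eq_hnorm)
  then have "(hnorm H (\<Phi> f x))\<^sup>2 + (hnorm H (\<Phi> g x))\<^sup>2 = M\<^sup>2 * (hnorm H x)\<^sup>2"
    unfolding of_real_add[symmetric] of_real_eq_iff .
  then show "(hnorm H (\<Phi> f x))\<^sup>2 \<le> (M * hnorm H x)\<^sup>2"
    by (simp add: power_mult_distrib) (smt (verit) zero_le_power2)
  show "0 \<le> M * hnorm H x"
    using M0 x by simp
qed

context unitary_operator
begin

text \<open>Contractivity bounds the distance between \<open>\<Phi> f\<close> and
  \<open>\<Phi> g = T\<close> by the uniform distance of \<open>f\<close> from a Laurent polynomial
  \<open>g\<close>. Hence all functional calculi agree, by \<open>calc_unique\<close>.\<close>

lemma functional_calculus_calc: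
  assumes \<Phi>: "is_functional_calculus H U \<Phi>" and f: "continuous_on (sphere 0 1) f"
  shows "calc f (\<Phi> f)"
  unfolding calc_def
proof (intro conjI allI impI)
  show "\<Phi> f \<in> bounded_ops H"
    using \<Phi> f unfolding is_functional_calculus_def by blast
  fix e :: real assume "e > 0"
  then obtain g T where g: "laurent g T" "\<forall>z\<in>sphere 0 1. cmod (f z - g z) \<le> e"
    using laurent_dense[OF f] by blast
  have gc: "continuous_on (sphere 0 1) g"
    using g(1) by (rule laurent_continuous)
  have mg: "continuous_on (sphere 0 1) (\<lambda>z. (-1) * g z)" and d: "continuous_on (sphere 0 1) (\<lambda>z. f z + (-1) * g z)"
    by (intro continuous_intros f gc)+
  have s: "\<Phi> (\<lambda>z. (-1) * g z) = op_scl H (-1) (\<Phi> g)"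
    using \<Phi> gc unfolding is_functional_calculus_def by blast
  have "\<Phi> (\<lambda>z. f z + (-1) * g z) = op_add H (\<Phi> f) (\<Phi> (\<lambda>z. (-1) * g z))"
    using \<Phi> f mg unfolding is_functional_calculus_def by blast
  then have eq: "\<Phi> (\<lambda>z. f z + (-1) * g z) x = \<Phi> f x - T x" if "x \<in> Space H" for x
    using that functional_calculus_laurent[OF \<Phi> g(1)] s
    by (simp add: op_add_def op_scl_def)
  have "hnorm H (\<Phi> f x - T x) \<le> e * hnorm H x" if x: "x \<in> Space H" for x
    using functional_calculus_norm[OF \<Phi> d _ x, of e] g(2) eq[OF x] by simp
  with g show "\<exists>g T. laurent g T \<and> (\<forall>z\<in>sphere 0 1. cmod (f z - g z) \<le> e) \<and>
      (\<forall>x\<in>Space H. hnorm H (\<Phi> f x - T x) \<le> e * hnorm H x)"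
    by blast
qed

text \<open>Justifies the definite description; afterwards \<open>fun_calc\<close> is handled only
  through \<open>calc\<close>.\<close>

lemma calc_fun_calc:
  assumes f: "continuous_on (sphere 0 1) f"
  shows "calc f (fun_calc H f U)"
proof -
  obtain \<Phi> where \<Phi>: "is_functional_calculus H U \<Phi>" "calc f (\<Phi> f)"
    using functional_calculus_exists f by blast
  have "fun_calc H f U = \<Phi> f"
    unfolding fun_calc_def
  proof (rule the_equality)
    show "\<exists>\<Psi>. is_functional_calculus H U \<Psi> \<and> \<Phi> f = \<Psi> f"
      using \<Phi>(1) by blast
    show "A = \<Phi> f" if "\<exists>\<Psi>. is_functional_calculus H U \<Psi> \<and> A = \<Psi> f" for A
      using that functional_calculus_calc[OF _ f] calc_unique[OF _ \<Phi>(2)] by blast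
  qed
  with \<Phi>(2) show ?thesis by simp
qed

end

section \<open>Conjugation by a unitary operator\<close>

lemma unitary_operator_conj:
  assumes "unitary_operator H U Us" "unitary_operator H J Js"
  shows "unitary_operator H (compose (Space H) J (compose (Space H) U Js))
           (compose (Space H) J (compose (Space H) Us Js))"
proof -
  interpret U: unitary_operator H U Us by fact
  interpret J: unitary_operator H J Js by fact
  have Js: "is_adjoint H Js J"
    by (rule U.is_adjoint_sym[OF J.U_adjoint]) simp_all
  show ?thesis
  proof unfold_locales
    show "is_adjoint H (compose (Space H) J (compose (Space H) U Js))
           (compose (Space H) J (compose (Space H) Us Js))"
      unfolding is_adjoint_def
    proof (intro ballI)
      fix x y assume xy: "x \<in> Space H" "y \<in> Space H"
      have "ip H (J (U (Js x))) y = ip H (U (Js x)) (Js y)"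
        using xy by (intro U.is_adjointD[OF J.U_adjoint]) auto
      also have "\<dots> = ip H (Js x) (Us (Js y))"
        using xy by (intro U.is_adjointD[OF U.U_adjoint]) auto
      also have "\<dots> = ip H x (J (Us (Js y)))"
        using xy by (intro U.is_adjointD[OF Js]) auto
      finally show "ip H (compose (Space H) J (compose (Space H) U Js) x) y =
          ip H x (compose (Space H) J (compose (Space H) Us Js) y)"
        using xy by (simp add: compose_def)
    qed
  qed (simp, simp, simp_all add: compose_def)
qed

lemma laurent_conj:
  assumes U: "unitary_operator H U Us" and J: "unitary_operator H J Js"
    and T: "unitary_operator.laurent H U Us f T"
  shows "unitary_operator.laurent H (compose (Space H) J (compose (Space H) U Js))
           (compose (Space H) J (compose (Space H) Us Js)) f
           (compose (Space H) J (compose (Space H) T Js))"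
proof -
  interpret U: unitary_operator H U Us by fact
  interpret J: unitary_operator H J Js by fact
  let ?C = "\<lambda>T. compose (Space H) J (compose (Space H) T Js)"
  interpret W: unitary_operator H "?C U" "?C Us"
    using U J by (rule unitary_operator_conj)
  show ?thesis
    using T
  proof (induction rule: U.laurent.induct)
    case one
    have "?C (op_id H) = op_id H"
      by (rule U.bounded_ops_eqI, simp, simp) (simp add: compose_def op_id_def)
    then show ?case using W.laurent.one by simp
  next
    case ident
    show ?case by (rule W.laurent.ident)
  next
    case conj
    show ?case by (rule W.laurent.conj)
  next
    case (add f S g T)
    have "?C (op_add H S T) = op_add H (?C S) (?C T)"
      using add.hyps
      by (intro U.bounded_ops_eqI U.compose_bounded U.op_add_bounded U.op_scl_bounded J.U_bounded J.Us_bounded)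
         (simp_all add: U.laurent_bounded U.laurent_Space compose_def op_add_def U.bounded_opsD(2)[OF J.U_bounded])
    then show ?case using W.laurent.add[OF add.IH] by simp
  next
    case (scl f T c)
    have "?C (op_scl H c T) = op_scl H c (?C T)"
      using scl.hyps
      by (intro U.bounded_ops_eqI U.compose_bounded U.op_add_bounded U.op_scl_bounded J.U_bounded J.Us_bounded)
         (simp_all add: U.laurent_bounded U.laurent_Space compose_def op_scl_def U.bounded_opsD(3)[OF J.U_bounded])
    then show ?case using W.laurent.scl[OF scl.IH] by simp
  next
    case (mult f S g T)
    have "?C (compose (Space H) S T) = compose (Space H) (?C S) (?C T)"
      using mult.hyps
      by (intro U.bounded_ops_eqI U.compose_bounded U.op_add_bounded U.op_scl_bounded J.U_bounded J.Us_bounded)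
         (simp_all add: U.laurent_bounded U.laurent_Space compose_def)
    then show ?case using W.laurent.mult[OF mult.IH] by simp
  qed
qed

text \<open>Conjugation is isometric and, by \<open>laurent_conj\<close>, keeps symbols. Conjugated
  approximants therefore show that the right-hand side satisfies \<open>calc\<close> for the
  conjugated unitary, and uniqueness identifies it.\<close>

lemma fun_calc_conj:
  assumes U: "unitary_operator H U Us" and J: "unitary_operator H J Js"
    and f: "continuous_on (sphere 0 1) f"
  shows "fun_calc H f (compose (Space H) J (compose (Space H) U Js)) =
           compose (Space H) J (compose (Space H) (fun_calc H f U) Js)"
proof -
  interpret U: unitary_operator H U Us by fact
  interpret J: unitary_operator H J Js by fact
  let ?C = "\<lambda>T. compose (Space H) J (compose (Space H) T Js)"
  interpret W: unitary_operator H "?C U" "?C Us"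
    using U J by (rule unitary_operator_conj)
  interpret J': unitary_operator H Js J
    by unfold_locales (auto intro!: U.is_adjoint_sym[OF J.U_adjoint])
  let ?A = "fun_calc H f U"
  have A: "U.calc f ?A"
    using f by (rule U.calc_fun_calc)
  have "W.calc f (?C ?A)"
    unfolding W.calc_def
  proof (intro conjI allI impI)
    show "?C ?A \<in> bounded_ops H"
      using U.calc_bounded[OF A] by simp
    fix e :: real assume e: "e > 0"
    obtain g T where g: "U.laurent g T" "\<And>z. z \<in> sphere 0 1 \<Longrightarrow> cmod (f z - g z) \<le> e"
      "\<And>x. x \<in> Space H \<Longrightarrow> hnorm H (?A x - T x) \<le> e * hnorm H x"
      by (rule U.calc_obtain[OF A e]) (rule that)
    show "\<exists>g T. W.laurent g T \<and> (\<forall>z\<in>sphere 0 1. cmod (f z - g z) \<le> e) \<and>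
        (\<forall>x\<in>Space H. hnorm H (?C ?A x - T x) \<le> e * hnorm H x)"
    proof (intro exI conjI ballI)
      show "W.laurent g (?C T)"
        by (rule laurent_conj[OF U J g(1)])
      show "cmod (f z - g z) \<le> e" if "z \<in> sphere 0 1" for z
        by (rule g(2)[OF that])
      fix x assume x: "x \<in> Space H"
      have sp: "?A (Js x) \<in> Space H" "T (Js x) \<in> Space H"
        using x U.calc_Space[OF A] U.laurent_Space[OF g(1)] by auto
      have "?C ?A x - ?C T x = J (?A (Js x) - T (Js x))"
        using x sp by (simp add: compose_def U.bounded_ops_diff[OF J.U_bounded])
      then have "hnorm H (?C ?A x - ?C T x) = hnorm H (?A (Js x) - T (Js x))"
        using sp by simp
      also have "\<dots> \<le> e * hnorm H (Js x)"
        using x by (intro g(3)) auto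
      also have "hnorm H (Js x) = hnorm H x"
        using x by (rule J'.hnorm_U)
      finally show "hnorm H (?C ?A x - ?C T x) \<le> e * hnorm H x" .
    qed
  qed
  then show ?thesis
    using W.calc_unique[OF W.calc_fun_calc[OF f]] by blast
qed

section \<open>The Hilbert space of square summable bilateral sequences\<close>

definition l2 :: "(int \<Rightarrow> complex) inner_space" where
  "l2 = \<lparr>Space = {x. (\<lambda>i. (cmod (x i))\<^sup>2) summable_on UNIV},
         scl = (\<lambda>c x i. c * x i),
         ip = (\<lambda>x y. \<Sum>\<^sub>\<infinity>i. x i * cnj (y i))\<rparr>"

lemma l2_iff: "x \<in> Space l2 \<longleftrightarrow> (\<lambda>i. (cmod (x i))\<^sup>2) summable_on UNIV"
  by (simp add: l2_def)

lemma scl_l2 [simp]: "scl l2 c x = (\<lambda>i. c * x i)"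
  by (simp add: l2_def)

lemma ip_l2: "ip l2 x y = (\<Sum>\<^sub>\<infinity>i. x i * cnj (y i))"
  by (simp add: l2_def)

lemma l2_abs_summable:
  assumes "x \<in> Space l2" "y \<in> Space l2"
  shows "(\<lambda>i. norm (x i * cnj (y i))) summable_on UNIV"
  by (rule abs_summable_product)
     (use assms in \<open>simp_all add: l2_iff norm_mult power2_eq_square\<close>)

lemma l2_summable:
  assumes "x \<in> Space l2" "y \<in> Space l2"
  shows "(\<lambda>i. x i * cnj (y i)) summable_on UNIV"
  using l2_abs_summable[OF assms] by (rule abs_summable_summable)

text \<open>A family without a sum has \<open>infsum\<close> equal to \<open>0\<close> on both
  sides, so \<open>hnorm_l2\<close> holds for every sequence.\<close>

lemma infsum_complex_of_real: "(\<Sum>\<^sub>\<infinity>i\<in>A. complex_of_real (f i)) = complex_of_real (\<Sum>\<^sub>\<infinity>i\<in>A. f i)"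
  by (rule infsum_bounded_linear_strong[OF _ bounded_linear_of_real])
     (use summable_on_Re[of "\<lambda>i. complex_of_real (f i)" A] in \<open>auto intro: summable_on_of_real\<close>)

lemma ip_l2_self: "ip l2 x x = complex_of_real (\<Sum>\<^sub>\<infinity>i. (cmod (x i))\<^sup>2)"
  by (simp only: ip_l2 infsum_complex_of_real complex_norm_square[symmetric])

lemma hnorm_l2: "hnorm l2 x = sqrt (\<Sum>\<^sub>\<infinity>i. (cmod (x i))\<^sup>2)"
  by (simp add: hnorm_def ip_l2_self)

lemma sum_le_hnorm_l2:
  assumes "x \<in> Space l2" "finite F"
  shows "(\<Sum>i\<in>F. (cmod (x i))\<^sup>2) \<le> (hnorm l2 x)\<^sup>2"
proof -
  have "(\<Sum>i\<in>F. (cmod (x i))\<^sup>2) \<le> (\<Sum>\<^sub>\<infinity>i. (cmod (x i))\<^sup>2)"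
    using assms by (intro finite_sum_le_infsum) (auto simp: l2_iff)
  also have "\<dots> = (hnorm l2 x)\<^sup>2"
    by (simp add: hnorm_l2 infsum_nonneg)
  finally show ?thesis .
qed

lemma cmod_le_hnorm_l2:
  assumes "x \<in> Space l2"
  shows "cmod (x i) \<le> hnorm l2 x"
proof (rule power2_le_imp_le)
  show "(cmod (x i))\<^sup>2 \<le> (hnorm l2 x)\<^sup>2"
    using sum_le_hnorm_l2[OF assms, of "{i}"] by simp
  show "0 \<le> hnorm l2 x"
    by (simp add: hnorm_l2 infsum_nonneg)
qed

text \<open>The converse of \<open>sum_le_hnorm_l2\<close>. Together they reduce norm bounds to
  finite sums, where coordinatewise limits may be taken.\<close>

lemma l2_sums_bounded:
  assumes "\<And>F. finite F \<Longrightarrow> (\<Sum>i\<in>F. (cmod (x i))\<^sup>2) \<le> C\<^sup>2" and "C \<ge> 0"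
  shows "x \<in> Space l2" "hnorm l2 x \<le> C"
proof -
  have "(\<lambda>i. (cmod (x i))\<^sup>2) summable_on UNIV"
    using assms(1) by (intro nonneg_bdd_above_summable_on bdd_aboveI2[of _ _ "C\<^sup>2"]) auto
  then show "x \<in> Space l2" by (simp add: l2_iff)
  have "(\<Sum>\<^sub>\<infinity>i. (cmod (x i))\<^sup>2) \<le> C\<^sup>2"
    by (rule infsum_le_finite_sums) (use assms(1) \<open>_ summable_on UNIV\<close> in auto)
  then show "hnorm l2 x \<le> C"
    using assms(2) by (simp add: hnorm_l2 real_le_lsqrt)
qed

lemma l2_add:
  assumes "x \<in> Space l2" "y \<in> Space l2"
  shows "x + y \<in> Space l2"
proof -
  have "(\<lambda>i. 2 * (cmod (x i))\<^sup>2 + 2 * (cmod (y i))\<^sup>2) summable_on UNIV"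
    using assms by (intro summable_on_add summable_on_cmult_right) (auto simp: l2_iff)
  moreover have "(cmod (x i + y i))\<^sup>2 \<le> 2 * (cmod (x i))\<^sup>2 + 2 * (cmod (y i))\<^sup>2" for i
  proof -
    have "(cmod (x i + y i))\<^sup>2 \<le> (cmod (x i) + cmod (y i))\<^sup>2"
      by (intro power_mono norm_triangle_ineq) simp
    also have "\<dots> \<le> 2 * (cmod (x i))\<^sup>2 + 2 * (cmod (y i))\<^sup>2"
      using zero_le_power2[of "cmod (x i) - cmod (y i)"] by (simp add: power2_sum power2_diff)
    finally show ?thesis .
  qed
  ultimately have "(\<lambda>i. (cmod (x i + y i))\<^sup>2) summable_on UNIV"
    by (rule summable_on_comparison_test) auto
  then show ?thesis
    by (simp add: l2_iff)
qed

lemma l2_scl: "x \<in> Space l2 \<Longrightarrow> (\<lambda>i. c * x i) \<in> Space l2"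
  by (simp add: l2_iff norm_mult power_mult_distrib summable_on_cmult_right)

lemma l2_diff:
  assumes "x \<in> Space l2" "y \<in> Space l2"
  shows "x - y \<in> Space l2"
proof -
  have eq: "x - y = x + (\<lambda>i. (-1) * y i)"
    by (simp add: fun_eq_iff)
  show ?thesis
    unfolding eq by (intro l2_add l2_scl assms)
qed

lemma l2_complete:
  assumes X: "\<And>n::nat. X n \<in> Space l2"
    and Cauchy: "\<And>e. e > 0 \<Longrightarrow> \<exists>N. \<forall>m\<ge>N. \<forall>n\<ge>N. hnorm l2 (X m - X n) < e"
  shows "\<exists>x\<in>Space l2. (\<lambda>n. hnorm l2 (X n - x)) \<longlonglongrightarrow> 0"
proof -
  have "\<exists>l. (\<lambda>n. X n i) \<longlonglongrightarrow> l" for i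
  proof -
    have "Cauchy (\<lambda>n. X n i)"
    proof (rule CauchyI)
      fix e :: real assume "0 < e"
      then obtain N where N: "\<forall>m\<ge>N. \<forall>n\<ge>N. hnorm l2 (X m - X n) < e"
        using Cauchy by blast
      have "cmod (X m i - X n i) < e" if "m \<ge> N" "n \<ge> N" for m n
        using cmod_le_hnorm_l2[OF l2_diff[OF X X], of m n i] N[rule_format, OF that] by simp
      then show "\<exists>M. \<forall>m\<ge>M. \<forall>n\<ge>M. norm (X m i - X n i) < e" by blast
    qed
    then show ?thesis
      using Cauchy_convergent_iff convergent_def by blast
  qed
  then obtain L where L: "\<And>i. (\<lambda>n. X n i) \<longlonglongrightarrow> L i" by metis
  have close: "\<exists>N. \<forall>m\<ge>N. X m - L \<in> Space l2 \<and> hnorm l2 (X m - L) \<le> e" if "e > 0" for e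
  proof -
    obtain N where N: "\<forall>m\<ge>N. \<forall>n\<ge>N. hnorm l2 (X m - X n) < e"
      using Cauchy \<open>e > 0\<close> by blast
    have *: "(\<Sum>i\<in>F. (cmod ((X m - L) i))\<^sup>2) \<le> e\<^sup>2" if m: "m \<ge> N" and F: "finite F" for m F
    proof (rule tendsto_upperbound)
      show "(\<lambda>n. \<Sum>i\<in>F. (cmod (X m i - X n i))\<^sup>2) \<longlonglongrightarrow> (\<Sum>i\<in>F. (cmod ((X m - L) i))\<^sup>2)"
        by (auto intro!: tendsto_intros L)
      show "\<forall>\<^sub>F n in sequentially. (\<Sum>i\<in>F. (cmod (X m i - X n i))\<^sup>2) \<le> e\<^sup>2"
        using eventually_ge_at_top[of N]
      proof eventually_elim
        case (elim n)
        have "(\<Sum>i\<in>F. (cmod ((X m - X n) i))\<^sup>2) \<le> (hnorm l2 (X m - X n))\<^sup>2"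
          by (intro sum_le_hnorm_l2 l2_diff X F)
        also have "\<dots> \<le> e\<^sup>2"
          using N m elim by (intro power_mono) (auto simp: hnorm_l2 infsum_nonneg less_imp_le)
        finally show ?case by simp
      qed
    qed simp
    have "X m - L \<in> Space l2 \<and> hnorm l2 (X m - L) \<le> e" if "m \<ge> N" for m
      using l2_sums_bounded[of "X m - L" e, OF *[OF that] less_imp_le[OF \<open>e > 0\<close>]] by blast
    then show ?thesis by blast
  qed
  obtain m where "X m - L \<in> Space l2"
    using close[OF zero_less_one] by blast
  then have "X m - (X m - L) \<in> Space l2"
    by (rule l2_diff[OF X])
  moreover have "X m - (X m - L) = L"
    by (simp add: fun_eq_iff)
  ultimately have "L \<in> Space l2"
    by metis
  moreover have "(\<lambda>n. hnorm l2 (X n - L)) \<longlonglongrightarrow> 0"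
  proof (rule LIMSEQ_I)
    fix r :: real assume "0 < r"
    then obtain N where "\<forall>m\<ge>N. X m - L \<in> Space l2 \<and> hnorm l2 (X m - L) \<le> r / 2"
      using close[of "r / 2"] by auto
    then have "\<forall>n\<ge>N. norm (hnorm l2 (X n - L) - 0) < r"
      using \<open>0 < r\<close> by (fastforce simp: hnorm_l2 infsum_nonneg)
    then show "\<exists>no. \<forall>n\<ge>no. norm (hnorm l2 (X n - L) - 0) < r" by blast
  qed
  ultimately show ?thesis by blast
qed

lemma hilbert_space_l2: "hilbert_space l2"
proof -
  interpret vector_space "scl l2"
    by unfold_locales (auto simp: fun_eq_iff algebra_simps)
  show ?thesis
  proof unfold_locales
    show "subspace (Space l2)"
      unfolding subspace_def by (auto simp: l2_add l2_scl) (simp add: l2_iff)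
    fix x y z :: "int \<Rightarrow> complex" and c :: complex
    show "ip l2 (x + y) z = ip l2 x z + ip l2 y z"
      if "x \<in> Space l2" "y \<in> Space l2" "z \<in> Space l2"
      using that by (simp add: ip_l2 distrib_right infsum_add l2_summable)
    show "ip l2 (scl l2 c x) y = c * ip l2 x y" if "x \<in> Space l2" "y \<in> Space l2"
      by (simp add: ip_l2 mult.assoc infsum_cmult_right')
    show "ip l2 x y = cnj (ip l2 y x)"
      by (simp add: ip_l2 mult.commute flip: infsum_cnj)
    show "0 \<le> Re (ip l2 x x)"
      by (simp add: ip_l2_self infsum_nonneg)
    show "x = 0" if "x \<in> Space l2" "ip l2 x x = 0"
    proof
      fix i
      have "hnorm l2 x = 0" using that(2) by (simp add: hnorm_def)
      then show "x i = 0 i" using cmod_le_hnorm_l2[OF that(1), of i] by simp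
    qed
  qed (rule l2_complete)
qed

interpretation l2: hilbert_space l2
  by (rule hilbert_space_l2)

text \<open>Shifts and diagonal unitaries are both of the following form.\<close>

definition weighted_perm :: "(int \<Rightarrow> complex) \<Rightarrow> (int \<Rightarrow> int) \<Rightarrow> (int \<Rightarrow> complex) \<Rightarrow> int \<Rightarrow> complex" where
  "weighted_perm s p = (\<lambda>x\<in>Space l2. \<lambda>i. s i * x (p i))"

lemma weighted_perm_Space:
  assumes s: "\<And>i. cmod (s i) = 1" and p: "bij p" and x: "x \<in> Space l2"
  shows "(\<lambda>i. s i * x (p i)) \<in> Space l2" "hnorm l2 (\<lambda>i. s i * x (p i)) = hnorm l2 x"
  using x summable_on_reindex_bij_betw[OF p, of "\<lambda>i. (cmod (x i))\<^sup>2"]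
    infsum_reindex_bij_betw[OF p, of "\<lambda>i. (cmod (x i))\<^sup>2"]
  by (simp_all add: l2_iff hnorm_l2 norm_mult s)

lemma weighted_perm_bounded:
  assumes s: "\<And>i. cmod (s i) = 1" and p: "bij p"
  shows "weighted_perm s p \<in> bounded_ops l2"
proof (rule l2.bounded_opsI[where K = 1])
  show "weighted_perm s p \<in> extensional (Space l2)"
    by (simp add: weighted_perm_def)
  fix x assume x: "x \<in> Space l2"
  show "weighted_perm s p x \<in> Space l2"
    using weighted_perm_Space[OF s p x] x by (simp add: weighted_perm_def)
  show "hnorm l2 (weighted_perm s p x) \<le> 1 * hnorm l2 x"
    using weighted_perm_Space[OF s p x] x by (simp add: weighted_perm_def)
  show "weighted_perm s p (x + y) = weighted_perm s p x + weighted_perm s p y" if y: "y \<in> Space l2" for y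
    using x y by (simp add: weighted_perm_def l2_add fun_eq_iff distrib_left)
  show "weighted_perm s p (scl l2 c x) = scl l2 c (weighted_perm s p x)" for c
    using x by (simp add: weighted_perm_def l2_scl fun_eq_iff mult_ac)
qed

text \<open>Reindexing the inner product along \<open>q\<close> moves the weight from
  \<open>s i\<close> to \<open>s (q i)\<close>, which gives the adjoint; unimodular weights make it
  the inverse.\<close>

lemma unitary_operator_weighted_perm:
  assumes s: "\<And>i. cmod (s i) = 1" and p: "\<And>i. p (q i) = i" "\<And>i. q (p i) = i"
  shows "unitary_operator l2 (weighted_perm s p) (weighted_perm (\<lambda>i. cnj (s (q i))) q)"
proof -
  have bij: "bij p" "bij q"
    using p by (metis bijI' )+
  let ?s' = "\<lambda>i. cnj (s (q i))"
  have s': "cmod (?s' i) = 1" for i by (simp add: s)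
  have ss: "cnj (s i) * s i = 1" for i
    using complex_norm_square[of "s i"] s[of i] by (simp add: mult.commute)
  then have ss': "s i * cnj (s i) = 1" for i
    by (simp add: mult.commute)
  show ?thesis
  proof unfold_locales
    show "weighted_perm s p \<in> bounded_ops l2" "weighted_perm ?s' q \<in> bounded_ops l2"
      by (intro weighted_perm_bounded s s' bij)+
    show "is_adjoint l2 (weighted_perm s p) (weighted_perm ?s' q)"
      unfolding is_adjoint_def
    proof (intro ballI)
      fix x y assume "x \<in> Space l2" "y \<in> Space l2"
      then show "ip l2 (weighted_perm s p x) y = ip l2 x (weighted_perm ?s' q y)"
        using infsum_reindex_bij_betw[OF bij(2), of "\<lambda>i. s i * x (p i) * cnj (y i)"]
        by (simp add: weighted_perm_def ip_l2 p mult_ac)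
    qed
    fix x assume x: "x \<in> Space l2"
    note sp = weighted_perm_Space(1)[OF s bij(1) x] weighted_perm_Space(1)[OF s' bij(2) x]
    show "weighted_perm ?s' q (weighted_perm s p x) = x"
      using x sp p ss by (simp add: weighted_perm_def fun_eq_iff mult.assoc[symmetric])
    show "weighted_perm s p (weighted_perm ?s' q x) = x"
      using x sp p ss' by (simp add: weighted_perm_def fun_eq_iff mult.assoc[symmetric])
  qed
qed

section \<open>The lacunary symbol\<close>

lemma nn_integral_ge_const:
  fixes f :: "real \<Rightarrow> real"
  assumes "0 \<le> c" "I \<in> sets borel" "emeasure lborel I = ennreal l" "0 \<le> l" "\<And>t. t \<in> I \<Longrightarrow> c \<le> f t"
  shows "ennreal (c * l) \<le> (\<integral>\<^sup>+t\<in>I. ennreal (f t) \<partial>lborel)"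
proof -
  have "ennreal (c * l) = (\<integral>\<^sup>+t\<in>I. ennreal c \<partial>lborel)"
    using assms by (simp add: nn_integral_cmult_indicator ennreal_mult)
  also have "\<dots> \<le> (\<integral>\<^sup>+t\<in>I. ennreal (f t) \<partial>lborel)"
    using assms(5) by (intro nn_integral_mono) (auto simp: indicator_def ennreal_leI)
  finally show ?thesis .
qed

lemma suminf_nn_integral_disjoint_le:
  fixes f :: "real \<Rightarrow> ennreal"
  assumes "f \<in> borel_measurable borel" "\<And>k. I k \<in> sets borel" "disjoint_family I" "(\<Union>k. I k) \<subseteq> S"
  shows "(\<Sum>k. \<integral>\<^sup>+t\<in>I k. f t \<partial>lborel) \<le> (\<integral>\<^sup>+t\<in>S. f t \<partial>lborel)"
proof -
  have "(\<Sum>k. \<integral>\<^sup>+t\<in>I k. f t \<partial>lborel) = (\<integral>\<^sup>+t. (\<Sum>k. f t * indicator (I k) t) \<partial>lborel)"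
    using assms(1,2) by (intro nn_integral_suminf[symmetric]) auto
  also have "\<dots> = (\<integral>\<^sup>+t\<in>(\<Union>k. I k). f t \<partial>lborel)"
    using assms(3) by (simp add: suminf_indicator)
  also have "\<dots> \<le> (\<integral>\<^sup>+t\<in>S. f t \<partial>lborel)"
    using assms(4) by (intro nn_integral_mono) (auto simp: indicator_def)
  finally show ?thesis .
qed

lemma disjoint_familyI_less:
  fixes I :: "nat \<Rightarrow> 'a set"
  assumes "\<And>k l. k < l \<Longrightarrow> I k \<inter> I l = {}"
  shows "disjoint_family I"
  unfolding disjoint_family_on_def using assms by (metis Int_commute linorder_neqE_nat)

locale modulus =
  fixes \<omega> :: "real \<Rightarrow> real"
  assumes modulus: "modulus_of_continuity \<omega>"
begin

lemma omega_mono: "0 \<le> x \<Longrightarrow> x \<le> y \<Longrightarrow> \<omega> x \<le> \<omega> y"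
  using modulus by (auto simp: modulus_of_continuity_def mono_on_def)

lemma omega_nonneg: "0 \<le> x \<Longrightarrow> 0 \<le> \<omega> x"
  using omega_mono[of 0 x] modulus by (simp add: modulus_of_continuity_def)

lemma omega_double: "0 \<le> x \<Longrightarrow> \<omega> (2 * x) \<le> 2 * \<omega> x"
  using modulus unfolding modulus_of_continuity_def by (metis mult_2)

lemma omega_half: "0 \<le> x \<Longrightarrow> \<omega> x / 2 \<le> \<omega> (x / 2)"
  using omega_double[of "x / 2"] by simp

text \<open>Nothing is known about \<open>\<omega>\<close> at negative arguments, not even
  measurability; clamping changes nothing on the sets of integration.\<close>

lemma measurable_omega_max: "(\<lambda>t. \<omega> (max 0 t)) \<in> borel_measurable borel"
proof (rule borel_measurable_continuous_onI)
  have "continuous_on {0..} \<omega>"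
    using modulus by (simp add: modulus_of_continuity_def)
  then show "continuous_on UNIV (\<lambda>t. \<omega> (max 0 t))"
    by (rule continuous_on_compose2) (auto intro!: continuous_intros)
qed

text \<open>For \<open>d = (1/2) ^ k\<close> subadditivity bounds the integrand below by
  \<open>\<omega> d / 2 / d\<close>, on an interval of length \<open>d / 2\<close>: hence the
  4.\<close>

lemma dyadic_term_small:
  "ennreal (\<omega> ((1/2) ^ k)) \<le> 4 * (\<integral>\<^sup>+t\<in>{(1/2) ^ Suc k<..(1/2) ^ k}. ennreal (\<omega> (max 0 t) / t) \<partial>lborel)"
proof -
  define d :: real where "d = (1/2) ^ k"
  have d: "d > 0" by (simp add: d_def)
  have "ennreal ((\<omega> d / 2 / d) * (d / 2)) \<le> (\<integral>\<^sup>+t\<in>{d / 2<..d}. ennreal (\<omega> (max 0 t) / t) \<partial>lborel)"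
  proof (rule nn_integral_ge_const)
    fix t assume t: "t \<in> {d / 2<..d}"
    have "\<omega> d / 2 \<le> \<omega> t"
      using omega_half[of d] omega_mono[of "d / 2" t] t d by simp
    then show "\<omega> d / 2 / d \<le> \<omega> (max 0 t) / t"
      using t d omega_nonneg[of d] by (intro frac_le) (auto simp: max_def)
  qed (use d omega_nonneg[of d] in auto)
  then have "4 * ennreal (\<omega> d / 4) \<le> 4 * (\<integral>\<^sup>+t\<in>{d / 2<..d}. ennreal (\<omega> (max 0 t) / t) \<partial>lborel)"
    using d by (intro mult_left_mono) auto
  also have "4 * ennreal (\<omega> d / 4) = ennreal (4 * (\<omega> d / 4))"
    using d omega_nonneg[of d] by (subst ennreal_mult) auto
  finally show ?thesis
    by (simp add: d_def)
qed

text \<open>Here the 4 comes from \<open>t\<^sup>2 \<le> (2 * d)\<^sup>2\<close> on an interval of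
  length \<open>d\<close>. The interval lies to the right of \<open>d\<close>, so monotonicity of
  \<open>\<omega>\<close> is enough.\<close>

lemma dyadic_term_large:
  "ennreal (\<omega> ((1/2) ^ k) * 2 ^ k) \<le>
     4 * (\<integral>\<^sup>+t\<in>{(1/2) ^ k..<2 * (1/2) ^ k}. ennreal (\<omega> (max 0 t) / t\<^sup>2) \<partial>lborel)"
proof -
  define d :: real where "d = (1/2) ^ k"
  have d: "d > 0" by (simp add: d_def)
  have inv: "2 ^ k = 1 / d" by (simp add: d_def power_one_over)
  have "ennreal ((\<omega> d / (2 * d)\<^sup>2) * d) \<le> (\<integral>\<^sup>+t\<in>{d..<2 * d}. ennreal (\<omega> (max 0 t) / t\<^sup>2) \<partial>lborel)"
  proof (rule nn_integral_ge_const)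
    fix t assume t: "t \<in> {d..<2 * d}"
    have "\<omega> d \<le> \<omega> t"
      using omega_mono[of d t] t d by simp
    moreover have "t\<^sup>2 \<le> (2 * d)\<^sup>2"
      using t d by (intro power_mono) auto
    ultimately show "\<omega> d / (2 * d)\<^sup>2 \<le> \<omega> (max 0 t) / t\<^sup>2"
      using t d omega_nonneg[of d] by (intro frac_le) (auto simp: max_def)
  qed (use d omega_nonneg[of d] in auto)
  also have "(\<omega> d / (2 * d)\<^sup>2) * d = \<omega> d * 2 ^ k / 4"
    using d by (simp add: inv power2_eq_square)
  finally have "4 * ennreal (\<omega> d * 2 ^ k / 4) \<le> 4 * (\<integral>\<^sup>+t\<in>{d..<2 * d}. ennreal (\<omega> (max 0 t) / t\<^sup>2) \<partial>lborel)"
    by (intro mult_left_mono) auto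
  also have "4 * ennreal (\<omega> d * 2 ^ k / 4) = ennreal (4 * (\<omega> d * 2 ^ k / 4))"
    using d omega_nonneg[of d] by (subst ennreal_mult) auto
  finally show ?thesis
    by (simp add: d_def)
qed

text \<open>The minimum is \<open>1\<close> exactly when \<open>(1/2) ^ k \<le> \<delta>\<close>.
  Those terms are charged to intervals left of their dyadic point, inside
  \<open>{0<..\<delta>}\<close>; the others to intervals right of it, inside
  \<open>{\<delta>..}\<close>.\<close>

lemma dyadic_sum_le_omega_sharp:
  assumes "\<delta> > 0"
  shows "(\<Sum>k. ennreal (\<omega> ((1/2) ^ k) * min 1 (2 ^ k * \<delta>))) \<le> 4 * omega_sharp \<omega> \<delta>"
proof -
  define f where "f t = ennreal (\<omega> (max 0 t) / t)" for t
  define g where "g t = ennreal (\<omega> (max 0 t) / t\<^sup>2)" for t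
  \<comment> \<open>Each \<open>k\<close> owns one of \<open>I k\<close>, \<open>J k\<close>, the
    other being empty, so one bound covers both kinds of terms. Half-open intervals make the
    families disjoint.\<close>
  define I :: "nat \<Rightarrow> real set" where "I k = (if (1/2) ^ k \<le> \<delta> then {(1/2) ^ Suc k<..(1/2) ^ k} else {})" for k
  define J :: "nat \<Rightarrow> real set" where "J k = (if (1/2) ^ k \<le> \<delta> then {} else {(1/2) ^ k..<2 * (1/2) ^ k})" for k
  note [measurable] = measurable_omega_max
  have f: "f \<in> borel_measurable borel" and g: "g \<in> borel_measurable borel"
    unfolding f_def g_def by measurable
  have term_le: "ennreal (\<omega> ((1/2) ^ k) * min 1 (2 ^ k * \<delta>)) \<le>
      4 * (ennreal \<delta> * (\<integral>\<^sup>+t\<in>J k. g t \<partial>lborel) + (\<integral>\<^sup>+t\<in>I k. f t \<partial>lborel))" for k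
  proof (cases "(1/2) ^ k \<le> \<delta>")
    case True
    have "ennreal (\<omega> ((1/2) ^ k) * min 1 (2 ^ k * \<delta>)) \<le> ennreal (\<omega> ((1/2) ^ k) * 1)"
      by (intro ennreal_leI mult_left_mono omega_nonneg) auto
    also have "\<dots> \<le> 4 * (\<integral>\<^sup>+t\<in>I k. f t \<partial>lborel)"
      using dyadic_term_small[of k] True by (simp add: I_def f_def)
    also have "\<dots> \<le> 4 * (ennreal \<delta> * (\<integral>\<^sup>+t\<in>J k. g t \<partial>lborel) + (\<integral>\<^sup>+t\<in>I k. f t \<partial>lborel))"
      by (intro mult_left_mono) auto
    finally show ?thesis .
  next
    case False
    have "ennreal (\<omega> ((1/2) ^ k) * min 1 (2 ^ k * \<delta>)) \<le> ennreal (\<delta> * (\<omega> ((1/2) ^ k) * 2 ^ k))"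
      using mult_left_mono[OF min.cobounded2 omega_nonneg[of "(1/2) ^ k"], of 1 "2 ^ k * \<delta>"]
      by (intro ennreal_leI) (simp add: mult_ac)
    also have "\<dots> = ennreal \<delta> * ennreal (\<omega> ((1/2) ^ k) * 2 ^ k)"
      using assms omega_nonneg[of "(1/2) ^ k"] by (intro ennreal_mult) auto
    also have "\<dots> \<le> ennreal \<delta> * (4 * (\<integral>\<^sup>+t\<in>J k. g t \<partial>lborel))"
      using dyadic_term_large[of k] False by (intro mult_left_mono) (auto simp: J_def g_def)
    also have "\<dots> \<le> 4 * (ennreal \<delta> * (\<integral>\<^sup>+t\<in>J k. g t \<partial>lborel) + (\<integral>\<^sup>+t\<in>I k. f t \<partial>lborel))"
      by (simp add: distrib_left mult_ac)
    finally show ?thesis .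
  qed
  have mono: "(1/2::real) ^ l \<le> (1/2) ^ Suc k" if "k < l" for k l :: nat
    using that by (intro power_decreasing) auto
  have disj: "disjoint_family I" "disjoint_family J"
  proof (rule_tac [!] disjoint_familyI_less)
    fix k l :: nat assume "k < l"
    note le = mono[OF this]
    show "I k \<inter> I l = {}"
      using le unfolding I_def by (auto simp del: power_Suc)
    show "J k \<inter> J l = {}"
      using le unfolding J_def by auto
  qed
  have "(\<Sum>k. ennreal (\<omega> ((1/2) ^ k) * min 1 (2 ^ k * \<delta>))) \<le>
      (\<Sum>k. 4 * (ennreal \<delta> * (\<integral>\<^sup>+t\<in>J k. g t \<partial>lborel) + (\<integral>\<^sup>+t\<in>I k. f t \<partial>lborel)))"
    by (intro suminf_le term_le) auto
  also have "\<dots> = 4 * (ennreal \<delta> * (\<Sum>k. \<integral>\<^sup>+t\<in>J k. g t \<partial>lborel) + (\<Sum>k. \<integral>\<^sup>+t\<in>I k. f t \<partial>lborel))"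
    by (simp add: ennreal_suminf_cmult suminf_add[symmetric])
  also have "\<dots> \<le> 4 * (ennreal \<delta> * (\<integral>\<^sup>+t\<in>{\<delta>..}. g t \<partial>lborel) + (\<integral>\<^sup>+t\<in>{0<..\<delta>}. f t \<partial>lborel))"
  proof (intro mult_left_mono add_mono suminf_nn_integral_disjoint_le f g disj)
    show "(\<Union>k. J k) \<subseteq> {\<delta>..}"
      by (auto simp: J_def split: if_splits)
    show "(\<Union>k. I k) \<subseteq> {0<..\<delta>}"
    proof
      fix t assume "t \<in> (\<Union>k. I k)"
      then obtain k where "(1/2) ^ k \<le> \<delta>" "(1/2) ^ Suc k < t" "t \<le> (1/2) ^ k"
        by (auto simp: I_def split: if_splits)
      moreover have "(0::real) < (1/2) ^ Suc k" by simp
      ultimately have "0 < t" "t \<le> \<delta>" by linarith+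
      then show "t \<in> {0<..\<delta>}" by simp
    qed
  qed (auto simp: I_def J_def)
  also have "(\<integral>\<^sup>+t\<in>{\<delta>..}. g t \<partial>lborel) = (\<integral>\<^sup>+t\<in>{\<delta>..}. ennreal (\<omega> t / t\<^sup>2) \<partial>lborel)"
    using assms by (intro nn_integral_cong) (auto simp: g_def indicator_def max_def)
  also have "(\<integral>\<^sup>+t\<in>{0<..\<delta>}. f t \<partial>lborel) = (\<integral>\<^sup>+t\<in>{0<..\<delta>}. ennreal (\<omega> t / t) \<partial>lborel)"
    by (intro nn_integral_cong) (auto simp: f_def indicator_def max_def)
  finally show ?thesis
    by (simp add: omega_sharp_def)
qed

lemma dyadic_sum_le:
  assumes fin: "finite_valued (omega_sharp \<omega>)" and \<delta>: "\<delta> > 0"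
  shows "summable (\<lambda>k. \<omega> ((1/2) ^ k) * min 1 (2 ^ k * \<delta>))"
    and "(\<Sum>k. \<omega> ((1/2) ^ k) * min 1 (2 ^ k * \<delta>)) \<le> 4 * enn2real (omega_sharp \<omega> \<delta>)"
proof -
  let ?a = "\<lambda>k. \<omega> ((1/2) ^ k) * min 1 (2 ^ k * \<delta>)"
  have nonneg: "0 \<le> ?a k" for k
    using \<delta> omega_nonneg[of "(1/2) ^ k"] by simp
  obtain w where w: "omega_sharp \<omega> \<delta> = ennreal w" "w \<ge> 0"
    using fin \<delta> unfolding finite_valued_def by (metis enn2real_nonneg ennreal_enn2real infinity_ennreal_def)
  have le: "(\<Sum>k. ennreal (?a k)) \<le> ennreal (4 * w)"
    using dyadic_sum_le_omega_sharp[OF \<delta>] w by (simp add: ennreal_mult)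
  then show sum: "summable ?a"
    using nonneg by (intro summable_suminf_not_top) (auto simp: top_unique)
  have "ennreal (\<Sum>k. ?a k) \<le> ennreal (4 * w)"
    using le suminf_ennreal2[OF nonneg sum] by simp
  then show "(\<Sum>k. ?a k) \<le> 4 * enn2real (omega_sharp \<omega> \<delta>)"
    using w by simp
qed

text \<open>At \<open>\<delta> = 1\<close> every minimum is \<open>1\<close>.\<close>

lemma dyadic_summable:
  assumes "finite_valued (omega_sharp \<omega>)"
  shows "summable (\<lambda>k. \<omega> ((1/2) ^ k))"
  using dyadic_sum_le(1)[OF assms zero_less_one] by simp

section \<open>The symbol: continuity and membership in the Lambda space\<close>

definition lacunary :: "complex \<Rightarrow> complex" where
  "lacunary z = complex_of_real (\<Sum>k. 4 * \<omega> ((1/2) ^ k) * Re (z ^ (2 ^ k)))"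

lemma abs_Re_power_le: "cmod z = 1 \<Longrightarrow> \<bar>Re (z ^ n)\<bar> \<le> 1"
  using abs_Re_le_cmod[of "z ^ n"] by (simp add: norm_power)

lemma lacunary_term_le:
  assumes "cmod z = 1"
  shows "norm (4 * \<omega> ((1/2) ^ k) * Re (z ^ (2 ^ k))) \<le> 4 * \<omega> ((1/2) ^ k)"
  using abs_Re_power_le[OF assms, of "2 ^ k"] omega_nonneg[of "(1/2) ^ k"]
  by (simp add: abs_mult mult_left_le)

lemma lacunary_summable:
  assumes "finite_valued (omega_sharp \<omega>)" "cmod z = 1"
  shows "summable (\<lambda>k. 4 * \<omega> ((1/2) ^ k) * Re (z ^ (2 ^ k)))"
  by (rule summable_comparison_test'[where g = "\<lambda>k. 4 * \<omega> ((1/2) ^ k)" and N = 0])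
     (use assms dyadic_summable lacunary_term_le in \<open>auto intro: summable_mult\<close>)

text \<open>In terms of \<open>z\<close> and \<open>cnj z\<close> the partial sums are Laurent
  polynomials: besides continuity, this supplies explicit approximants for the operator in
  \<open>shift_calc_entry\<close>.\<close>

lemma lacunary_uniform_limit:
  assumes "finite_valued (omega_sharp \<omega>)"
  shows "uniform_limit (sphere 0 1)
    (\<lambda>n z. \<Sum>k<n. 2 * complex_of_real (\<omega> ((1/2) ^ k)) * (z ^ (2 ^ k) + cnj z ^ (2 ^ k))) lacunary sequentially"
proof -
  have "uniform_limit (sphere 0 1) (\<lambda>n z. \<Sum>k<n. 4 * \<omega> ((1/2) ^ k) * Re (z ^ (2 ^ k)))
      (\<lambda>z. \<Sum>k. 4 * \<omega> ((1/2) ^ k) * Re (z ^ (2 ^ k))) sequentially"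
    by (rule Weierstrass_m_test[where M = "\<lambda>k. 4 * \<omega> ((1/2) ^ k)"])
       (use lacunary_term_le dyadic_summable[OF assms] in \<open>auto intro: summable_mult\<close>)
  then have "uniform_limit (sphere 0 1) (\<lambda>n z. complex_of_real (\<Sum>k<n. 4 * \<omega> ((1/2) ^ k) * Re (z ^ (2 ^ k)))) 
      lacunary sequentially"
    unfolding lacunary_def[abs_def] by (rule bounded_linear.uniform_limit[OF bounded_linear_of_real])
  moreover have "complex_of_real (\<Sum>k<n. 4 * \<omega> ((1/2) ^ k) * Re (z ^ (2 ^ k))) =
      (\<Sum>k<n. 2 * complex_of_real (\<omega> ((1/2) ^ k)) * (z ^ (2 ^ k) + cnj z ^ (2 ^ k)))" for n z
    by (simp add: complex_add_cnj mult.assoc flip: complex_cnj_power)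
  ultimately show ?thesis by simp
qed

lemma lacunary_continuous:
  assumes "finite_valued (omega_sharp \<omega>)"
  shows "continuous_on (sphere 0 1) lacunary"
  by (rule uniform_limit_theorem[OF _ lacunary_uniform_limit[OF assms]])
     (auto intro!: always_eventually continuous_intros)

lemma lacunary_Lambda:
  assumes fin: "finite_valued (omega_sharp \<omega>)"
  shows "lacunary \<in> Lambda_space (\<lambda>x. enn2real (omega_sharp \<omega> x))"
proof -
  \<comment> \<open>32 is the product of the coefficient 4, the 2 bounding a difference of two real
    parts, and the 4 of \<open>dyadic_sum_le\<close>.\<close>
  have "cmod (lacunary \<zeta> - lacunary \<eta>) / enn2real (omega_sharp \<omega> (cmod (\<zeta> - \<eta>))) \<le> 32"
    if \<zeta>: "cmod \<zeta> = 1" and \<eta>: "cmod \<eta> = 1" and "\<zeta> \<noteq> \<eta>" for \<zeta> \<eta>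
  proof -
    define \<delta> where "\<delta> = cmod (\<zeta> - \<eta>)"
    define w where "w = enn2real (omega_sharp \<omega> \<delta>)"
    have \<delta>: "\<delta> > 0" using \<open>\<zeta> \<noteq> \<eta>\<close> by (simp add: \<delta>_def)
    have w: "w \<ge> 0" by (simp add: w_def)
    let ?t = "\<lambda>z k. 4 * \<omega> ((1/2) ^ k) * Re (z ^ (2 ^ k))"
    let ?a = "\<lambda>k. \<omega> ((1/2) ^ k) * min 1 (2 ^ k * \<delta>)"
    have le: "norm (?t \<zeta> k - ?t \<eta> k) \<le> 8 * ?a k" for k
    proof -
      have "\<bar>Re (\<zeta> ^ (2 ^ k)) - Re (\<eta> ^ (2 ^ k))\<bar> \<le> cmod (\<zeta> ^ (2 ^ k) - \<eta> ^ (2 ^ k))"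
        using abs_Re_le_cmod[of "\<zeta> ^ (2 ^ k) - \<eta> ^ (2 ^ k)"] by simp
      also have "\<dots> \<le> 2 ^ k * \<delta>"
        using norm_power_diff[of \<zeta> \<eta> "2 ^ k"] \<zeta> \<eta> by (simp add: \<delta>_def)
      finally have "\<bar>Re (\<zeta> ^ (2 ^ k)) - Re (\<eta> ^ (2 ^ k))\<bar> \<le> 2 * min 1 (2 ^ k * \<delta>)"
        using abs_Re_power_le[OF \<zeta>, of "2 ^ k"] abs_Re_power_le[OF \<eta>, of "2 ^ k"] \<delta>
        by (auto simp: min_def)
      then have "4 * \<omega> ((1/2) ^ k) * \<bar>Re (\<zeta> ^ (2 ^ k)) - Re (\<eta> ^ (2 ^ k))\<bar> \<le> 4 * \<omega> ((1/2) ^ k) * (2 * min 1 (2 ^ k * \<delta>))"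
        by (intro mult_left_mono) (use omega_nonneg[of "(1/2) ^ k"] in auto)
      moreover have "norm (?t \<zeta> k - ?t \<eta> k) = 4 * \<omega> ((1/2) ^ k) * \<bar>Re (\<zeta> ^ (2 ^ k)) - Re (\<eta> ^ (2 ^ k))\<bar>"
        using omega_nonneg[of "(1/2) ^ k"] by (simp add: abs_mult flip: right_diff_distrib)
      ultimately show ?thesis by simp
    qed
    have sum: "summable (\<lambda>k. 8 * ?a k)"
      by (intro summable_mult dyadic_sum_le(1)[OF fin \<delta>])
    have "lacunary \<zeta> - lacunary \<eta> = complex_of_real (\<Sum>k. ?t \<zeta> k - ?t \<eta> k)"
      by (simp add: lacunary_def suminf_diff[OF lacunary_summable[OF fin \<zeta>] lacunary_summable[OF fin \<eta>], symmetric])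
    then have "cmod (lacunary \<zeta> - lacunary \<eta>) = norm (\<Sum>k. ?t \<zeta> k - ?t \<eta> k)"
      by simp
    also have "\<dots> \<le> (\<Sum>k. 8 * ?a k)"
      by (rule norm_suminf_le[OF le sum])
    also have "\<dots> = 8 * (\<Sum>k. ?a k)"
      by (intro suminf_mult dyadic_sum_le(1)[OF fin \<delta>])
    also have "\<dots> \<le> 8 * (4 * w)"
      unfolding w_def by (intro mult_left_mono dyadic_sum_le(2)[OF fin \<delta>]) simp
    finally have "cmod (lacunary \<zeta> - lacunary \<eta>) \<le> 32 * w" by simp
    then have "cmod (lacunary \<zeta> - lacunary \<eta>) / w \<le> 32"
      \<comment> \<open>Division by zero yields \<open>0\<close>, which settles
        \<open>w = 0\<close>.\<close>
      using w by (cases "w = 0") (auto simp: pos_divide_le_eq)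
    then show ?thesis
      by (simp add: w_def \<delta>_def)
  qed
  then show ?thesis
    unfolding Lambda_space_def by (auto intro!: bdd_aboveI[of _ 32])
qed

end

section \<open>The shift and its rank one perturbation\<close>

definition shift :: "(int \<Rightarrow> complex) \<Rightarrow> int \<Rightarrow> complex" where
  "shift = weighted_perm (\<lambda>i. 1) (\<lambda>i. i - 1)"

definition shift_inv :: "(int \<Rightarrow> complex) \<Rightarrow> int \<Rightarrow> complex" where
  "shift_inv = weighted_perm (\<lambda>i. 1) (\<lambda>i. i + 1)"

definition flip :: "(int \<Rightarrow> complex) \<Rightarrow> int \<Rightarrow> complex" where
  "flip = weighted_perm (\<lambda>i. if 0 \<le> i then 1 else -1) (\<lambda>i. i)"

text \<open>With \<open>flip\<close> as the \<open>J\<close> of the overview,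
  \<open>flipped shift\<close> is \<open>V\<close>.\<close>

definition flipped :: "((int \<Rightarrow> complex) \<Rightarrow> int \<Rightarrow> complex) \<Rightarrow> (int \<Rightarrow> complex) \<Rightarrow> int \<Rightarrow> complex" where
  "flipped T = compose (Space l2) flip (compose (Space l2) T flip)"

interpretation shift: unitary_operator l2 shift shift_inv
  using unitary_operator_weighted_perm[of "\<lambda>i. 1" "\<lambda>i. i - 1" "\<lambda>i. i + 1"]
  by (simp add: shift_def shift_inv_def)

lemma flip_unitary: "unitary_operator l2 flip flip"
  using unitary_operator_weighted_perm[of "\<lambda>i. if 0 \<le> i then 1 else -1" "\<lambda>i. i" "\<lambda>i. i"]
  by (simp add: flip_def if_distrib[of cnj] cong: if_cong)

interpretation flip: unitary_operator l2 flip flip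
  by (rule flip_unitary)

lemma shift_apply: "x \<in> Space l2 \<Longrightarrow> shift x i = x (i - 1)"
  by (simp add: shift_def weighted_perm_def)

lemma shift_inv_apply: "x \<in> Space l2 \<Longrightarrow> shift_inv x i = x (i + 1)"
  by (simp add: shift_inv_def weighted_perm_def)

lemma flip_apply: "x \<in> Space l2 \<Longrightarrow> flip x i = (if 0 \<le> i then x i else - x i)"
  by (simp add: flip_def weighted_perm_def)

lemma flipped_apply: "x \<in> Space l2 \<Longrightarrow> flipped T x = flip (T (flip x))"
  by (simp add: flipped_def compose_def)

lemma shift_pow: 
  assumes "x \<in> Space l2"
  shows "(shift ^^ n) x i = x (i - int n)"
proof (induction n arbitrary: i)
  case (Suc n)
  then show ?case
    using assms by (simp add: shift_apply algebra_simps)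
qed simp

lemma shift_inv_pow:
  assumes "x \<in> Space l2"
  shows "(shift_inv ^^ n) x i = x (i + int n)"
proof (induction n arbitrary: i)
  case (Suc n)
  have "(shift_inv ^^ n) x \<in> Space l2"
    by (induction n) (use assms in auto)
  then show ?case
    using Suc by (simp add: shift_inv_apply algebra_simps)
qed simp

lemma shift_laurent_sum:
  fixes N :: nat
  shows "\<exists>T. shift.laurent (\<lambda>z. \<Sum>k<N. a k * (z ^ (d k) + cnj z ^ (d k))) T \<and>
     (\<forall>x\<in>Space l2. \<forall>i. T x i = (\<Sum>k<N. a k * (x (i - int (d k)) + x (i + int (d k)))))"
proof (induction N)
  case 0
  \<comment> \<open>The rules of \<open>laurent\<close> produce the zero symbol only as a multiple,
    here of \<open>1\<close>.\<close>
  have "shift.laurent (\<lambda>z. 0 * 1) (op_scl l2 0 (op_id l2))"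
    by (intro shift.laurent.intros)
  moreover have "\<forall>x\<in>Space l2. \<forall>i. op_scl l2 0 (op_id l2) x i = 0"
    by (simp add: op_scl_def)
  ultimately show ?case by auto
next
  case (Suc N)
  then obtain T where T: "shift.laurent (\<lambda>z. \<Sum>k<N. a k * (z ^ (d k) + cnj z ^ (d k))) T"
    "\<forall>x\<in>Space l2. \<forall>i. T x i = (\<Sum>k<N. a k * (x (i - int (d k)) + x (i + int (d k))))"
    by blast
  obtain P where P: "shift.laurent (\<lambda>z. z ^ d N) P" "\<forall>x\<in>Space l2. P x = (shift ^^ d N) x"
    using shift.laurent_power[OF shift.laurent.ident] by blast
  obtain Q where Q: "shift.laurent (\<lambda>z. cnj z ^ d N) Q" "\<forall>x\<in>Space l2. Q x = (shift_inv ^^ d N) x"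
    using shift.laurent_power[OF shift.laurent.conj] by blast
  have "shift.laurent (\<lambda>z. (\<Sum>k<N. a k * (z ^ (d k) + cnj z ^ (d k))) + a N * (z ^ d N + cnj z ^ d N))
      (op_add l2 T (op_scl l2 (a N) (op_add l2 P Q)))"
    by (intro shift.laurent.add shift.laurent.scl T(1) P(1) Q(1))
  then have "shift.laurent (\<lambda>z. \<Sum>k<Suc N. a k * (z ^ (d k) + cnj z ^ (d k)))
      (op_add l2 T (op_scl l2 (a N) (op_add l2 P Q)))"
    by simp
  moreover have "op_add l2 T (op_scl l2 (a N) (op_add l2 P Q)) x i =
      (\<Sum>k<Suc N. a k * (x (i - int (d k)) + x (i + int (d k))))" if x: "x \<in> Space l2" for x i
    using x T(2) P(2) Q(2) shift_pow[OF x] shift_inv_pow[OF x]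
    by (simp add: op_add_def op_scl_def)
  ultimately show ?case by blast
qed

text \<open>Selects the block: \<open>2 ^ n\<close> must exceed the rank \<open>m\<close>, yet stay
  comparable to it.\<close>

lemma power2_between:
  fixes m :: nat
  shows "\<exists>n. m + 1 \<le> 2 ^ n \<and> 2 ^ n \<le> 2 * (m + 1)"
proof (induction m)
  case 0
  show ?case by (intro exI[of _ 0]) simp
next
  case (Suc m)
  then obtain n where n: "m + 1 \<le> 2 ^ n" "2 ^ n \<le> 2 * (m + 1)" by blast
  show ?case
  proof (cases "Suc m + 1 \<le> 2 ^ n")
    case True
    then show ?thesis using n by (intro exI[of _ n]) simp
  next
    case False
    \<comment> \<open>In this case \<open>2 ^ n = m + 1\<close>.\<close>
    then show ?thesis using n by (intro exI[of _ "Suc n"]) simp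
  qed
qed

text \<open>Conjugation by \<open>flip\<close> negates exactly the matrix entries joining a negative
  index to a nonnegative one. The shift has a single nonzero such entry, from \<open>-1\<close> to
  \<open>0\<close>.\<close>

lemma rank_shift_diff: "op_rank l2 (op_diff l2 shift (flipped shift)) = 1"
proof -
  define \<delta> :: "int \<Rightarrow> complex" where "\<delta> i = (if i = 0 then 1 else 0)" for i
  have diff: "op_diff l2 shift (flipped shift) x = scl l2 (2 * x (-1)) \<delta>" if x: "x \<in> Space l2" for x
    using x by (auto simp: op_diff_def flipped_apply fun_eq_iff shift_apply flip_apply \<delta>_def)
  have "op_diff l2 shift (flipped shift) ` Space l2 = l2.span {\<delta>}"
  proof
    show "op_diff l2 shift (flipped shift) ` Space l2 \<subseteq> l2.span {\<delta>}"
      using diff by (auto simp only: l2.span_singleton image_iff)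
    show "l2.span {\<delta>} \<subseteq> op_diff l2 shift (flipped shift) ` Space l2"
    proof
      fix y assume "y \<in> l2.span {\<delta>}"
      then obtain c where c: "y = scl l2 c \<delta>"
        by (auto simp only: l2.span_singleton)
      define x :: "int \<Rightarrow> complex" where "x i = (if i = -1 then c / 2 else 0)" for i
      have "(\<lambda>i. (cmod (x i))\<^sup>2) summable_on UNIV"
        by (rule finite_nonzero_values_imp_summable_on) (rule finite_subset[of _ "{-1}"], auto simp: x_def)
      then have "x \<in> Space l2" by (simp add: l2_iff)
      moreover have "op_diff l2 shift (flipped shift) x = y"
        using diff[OF \<open>x \<in> Space l2\<close>] by (simp add: c x_def)
      ultimately show "y \<in> op_diff l2 shift (flipped shift) ` Space l2" by blast
    qed
  qed
  moreover have "\<delta> 0 \<noteq> 0" by (simp add: \<delta>_def)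
  then have "\<delta> \<noteq> 0" by auto
  then have "l2.dim (l2.span {\<delta>}) = 1"
    by (simp add: l2.dim_eq_card_independent)
  ultimately show ?thesis
    unfolding op_rank_def one_enat_def by auto
qed

lemma l2_supported:
  assumes F: "finite F" and x: "\<And>i. i \<notin> F \<Longrightarrow> x i = 0"
  shows "x \<in> Space l2" "(hnorm l2 x)\<^sup>2 = (\<Sum>i\<in>F. (cmod (x i))\<^sup>2)"
proof -
  show "x \<in> Space l2"
    unfolding l2_iff
    by (rule finite_nonzero_values_imp_summable_on) (rule finite_subset[OF _ F], use x in auto)
  have "(\<Sum>\<^sub>\<infinity>i. (cmod (x i))\<^sup>2) = (\<Sum>\<^sub>\<infinity>i\<in>F. (cmod (x i))\<^sup>2)"
    by (rule infsum_cong_neutral) (use x in auto)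
  then show "(hnorm l2 x)\<^sup>2 = (\<Sum>i\<in>F. (cmod (x i))\<^sup>2)"
    using F by (simp add: hnorm_l2 sum_nonneg)
qed

section \<open>Lower bound for the singular values\<close>

context modulus
begin

text \<open>Every partial sum with more than \<open>Suc n\<close> terms already has exactly this
  entry, so only the approximation error of the functional calculus remains, and it is arbitrarily
  small.\<close>

lemma shift_calc_entry:
  assumes fin: "finite_valued (omega_sharp \<omega>)"
    and x: "\<And>j. j \<notin> {-(2 ^ n)..-1} \<Longrightarrow> x j = 0" and i: "i \<in> {2 ^ n..<2 ^ Suc n}"
  shows "fun_calc l2 lacunary shift x i = 2 * complex_of_real (\<omega> ((1/2) ^ Suc n)) * x (i - 2 ^ Suc n)"
proof -
  define A where "A = fun_calc l2 lacunary shift"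
  have xs: "x \<in> Space l2"
    using x by (intro l2_supported(1)[of "{-(2 ^ n)..-1}"]) auto
  have A: "shift.calc lacunary A"
    unfolding A_def by (rule shift.calc_fun_calc[OF lacunary_continuous[OF fin]])
  let ?a = "\<lambda>k. 2 * complex_of_real (\<omega> ((1/2) ^ k))"
  let ?v = "?a (Suc n) * x (i - 2 ^ Suc n)"
  have "cmod (A x i - ?v) \<le> 0 + e' " if "e' > 0" for e' :: real
  proof -
    define e where "e = e' / (hnorm l2 x + 1)"
    have "hnorm l2 x \<ge> 0" using xs by simp
    then have e: "e > 0" and "e * (hnorm l2 x + 1) = e'"
      using \<open>e' > 0\<close> by (simp_all add: e_def add_nonneg_pos)
    then have small: "e * hnorm l2 x \<le> e'" by (simp add: distrib_left)
    have "\<forall>\<^sub>F N in sequentially. \<forall>z\<in>sphere 0 1.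
        dist (\<Sum>k<N. ?a k * (z ^ (2 ^ k) + cnj z ^ (2 ^ k))) (lacunary z) < e"
      using lacunary_uniform_limit[OF fin] e by (simp add: uniform_limit_iff)
    then have "\<forall>\<^sub>F N in sequentially. N > Suc n \<and> (\<forall>z\<in>sphere 0 1.
        dist (\<Sum>k<N. ?a k * (z ^ (2 ^ k) + cnj z ^ (2 ^ k))) (lacunary z) < e)"
      using eventually_gt_at_top[of "Suc n"] by (rule eventually_conj[rotated])
    then obtain N where N: "N > Suc n" and close: "\<forall>z\<in>sphere 0 1.
        dist (\<Sum>k<N. ?a k * (z ^ (2 ^ k) + cnj z ^ (2 ^ k))) (lacunary z) < e"
      using eventually_happens'[OF sequentially_bot] by blast
    obtain T where T: "shift.laurent (\<lambda>z. \<Sum>k<N. ?a k * (z ^ (2 ^ k) + cnj z ^ (2 ^ k))) T"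
      "\<forall>x\<in>Space l2. \<forall>i. T x i = (\<Sum>k<N. ?a k * (x (i - int (2 ^ k)) + x (i + int (2 ^ k))))"
      using shift_laurent_sum[where N = N and a = ?a and d = "\<lambda>k. 2 ^ k"] by blast
    have "hnorm l2 (A x - T x) \<le> e * hnorm l2 x"
      by (rule shift.calc_dist[OF A shift.laurent_calc[OF T(1)] _ xs])
         (use close in \<open>simp add: dist_norm norm_minus_commute less_imp_le\<close>)
    moreover have "A x - T x \<in> Space l2"
      using xs shift.calc_Space[OF A] shift.laurent_Space[OF T(1)] by (intro l2_diff) auto
    ultimately have "cmod (A x i - T x i) \<le> e'"
      using cmod_le_hnorm_l2[of "A x - T x" i] small by simp
    moreover have "T x i = ?v"
    proof -
      \<comment> \<open>For a row \<open>i\<close> and a column \<open>j\<close> of the block,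
        \<open>i - j\<close> lies strictly between \<open>2 ^ n\<close> and
        \<open>3 * 2 ^ n\<close>, where the only power of two is \<open>2 ^ Suc n\<close>. The
        conjugate terms look at indices above \<open>i\<close>, outside the support.\<close>
      have "?a k * (x (i - int (2 ^ k)) + x (i + int (2 ^ k))) = (if k = Suc n then ?v else 0)" for k
      proof -
        have "(0::int) < 2 ^ n" "(0::int) < 2 ^ k" by simp_all
        moreover have "2 ^ n \<le> i" using i by simp
        ultimately have "\<not> i + 2 ^ k \<le> -1" by linarith
        then have "x (i + int (2 ^ k)) = 0"
          by (intro x) auto
        moreover have "x (i - int (2 ^ k)) = 0" if "k \<noteq> Suc n"
        proof (cases "k \<le> n")
          case True
          then have "(2::int) ^ k \<le> 2 ^ n" by (intro power_increasing) auto
          moreover have "2 ^ n \<le> i" using i by simp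
          ultimately have "\<not> i - 2 ^ k \<le> -1" by linarith
          then show ?thesis by (intro x) auto
        next
          case False
          then have "(2::int) ^ Suc (Suc n) \<le> 2 ^ k"
            using that by (intro power_increasing) auto
          moreover have "i < 2 * 2 ^ n" "(0::int) < 2 ^ n" using i by simp_all
          ultimately have "\<not> - (2 ^ n) \<le> i - 2 ^ k"
            unfolding power_Suc by linarith
          then show ?thesis by (intro x) auto
        qed
        ultimately show ?thesis by auto
      qed
      then have "T x i = (\<Sum>k<N. if k = Suc n then ?v else 0)"
        using T(2) xs by simp
      also have "\<dots> = ?v" using N by simp
      finally show ?thesis .
    qed
    ultimately show ?thesis by simp
  qed
  then have "cmod (A x i - ?v) \<le> 0"
    by (rule field_le_epsilon)
  then show ?thesis by (simp add: A_def)
qed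

text \<open>On vectors supported at negative indices \<open>flip\<close> is \<open>-1\<close>, on
  rows \<open>i \<ge> 0\<close> it is \<open>1\<close>, so there the difference is twice
  \<open>A x\<close>. The rows of the block alone carry the bound: translation by
  \<open>2 ^ Suc n\<close> maps its columns bijectively onto them.\<close>

lemma hankel_block_lower_bound:
  assumes fin: "finite_valued (omega_sharp \<omega>)"
    and x: "\<And>j. j \<notin> {-(2 ^ n)..-1} \<Longrightarrow> x j = 0"
  defines "A \<equiv> fun_calc l2 lacunary shift"
  shows "4 * \<omega> ((1/2) ^ Suc n) * hnorm l2 x \<le> hnorm l2 (op_diff l2 A (flipped A) x)"
proof (rule power2_le_imp_le)
  define w where "w = \<omega> ((1/2) ^ Suc n)"
  have w: "w \<ge> 0" unfolding w_def by (intro omega_nonneg) simp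
  have A: "A \<in> bounded_ops l2"
    unfolding A_def by (rule shift.calc_bounded[OF shift.calc_fun_calc[OF lacunary_continuous[OF fin]]])
  have xs: "x \<in> Space l2" and norm_x: "(hnorm l2 x)\<^sup>2 = (\<Sum>j\<in>{-(2 ^ n)..-1}. (cmod (x j))\<^sup>2)"
    using l2_supported[of "{-(2 ^ n)..-1}" x] x by auto
  let ?D = "op_diff l2 A (flipped A)"
  have D: "?D \<in> bounded_ops l2"
    using A by (simp add: flipped_def)
  have "x i = 0" if "i \<ge> 0" for i
    using that by (intro x) auto
  then have flip_x: "flip x = scl l2 (-1) x"
    using xs by (auto simp: fun_eq_iff flip_apply)
  have entry: "?D x i = 4 * complex_of_real w * x (i - 2 ^ Suc n)" if i: "i \<in> {2 ^ n..<2 ^ Suc n}" for i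
  proof -
    have "i \<ge> 0" using i by (auto intro: order_trans[of _ "2 ^ n"])
    have "A (flip x) = scl l2 (-1) (A x)"
      unfolding flip_x by (rule l2.bounded_opsD(3)[OF A xs])
    then have "?D x i = 2 * A x i"
      using xs \<open>i \<ge> 0\<close> l2.bounded_opsD(1)[OF A] l2_scl[of "A x" "-1"]
      by (simp add: op_diff_def flipped_apply flip_apply)
    then show ?thesis
      using shift_calc_entry[OF fin x i] by (simp add: A_def w_def)
  qed
  have "(4 * w * hnorm l2 x)\<^sup>2 = (\<Sum>j\<in>{-(2 ^ n)..-1}. (4 * w * cmod (x j))\<^sup>2)"
    by (simp add: power_mult_distrib norm_x sum_distrib_left)
  also have "\<dots> = (\<Sum>i\<in>{2 ^ n..<2 ^ Suc n}. (4 * w * cmod (x (i - 2 ^ Suc n)))\<^sup>2)"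
    by (rule sum.reindex_bij_witness[of _ "\<lambda>i. i - 2 ^ Suc n" "\<lambda>j. j + 2 ^ Suc n"]) auto
  also have "\<dots> = (\<Sum>i\<in>{2 ^ n..<2 ^ Suc n}. (cmod (?D x i))\<^sup>2)"
    using w by (intro sum.cong refl) (simp add: entry norm_mult)
  also have "\<dots> \<le> (hnorm l2 (?D x))\<^sup>2"
    using l2.bounded_opsD(1)[OF D xs] by (intro sum_le_hnorm_l2) auto
  finally show "(4 * \<omega> ((1/2) ^ Suc n) * hnorm l2 x)\<^sup>2 \<le> (hnorm l2 (?D x))\<^sup>2"
    by (simp add: w_def)
  show "0 \<le> hnorm l2 (?D x)"
    using l2.bounded_opsD(1)[OF D xs] by simp
qed

lemma singular_value_lacunary:
  assumes fin: "finite_valued (omega_sharp \<omega>)"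
  defines "A \<equiv> fun_calc l2 lacunary shift"
  shows "\<omega> (inverse (1 + real m)) \<le> singular_value l2 (op_diff l2 A (flipped A)) m"
proof -
  obtain n where n: "m + 1 \<le> 2 ^ n" "2 ^ n \<le> 2 * (m + 1)"
    using power2_between by blast
  have "real (2 ^ n) \<le> real (2 * (m + 1))"
    using n(2) by (rule of_nat_mono)
  \<comment> \<open>One halving comes from \<open>2 ^ n \<le> 2 * (m + 1)\<close>, the other from
    the exponent \<open>Suc n\<close>; \<open>omega_half\<close> undoes each at the price of a
    factor 2.\<close>
  then have "inverse (1 + real m) / 2 / 2 \<le> (1/2) ^ Suc n"
    by (simp add: field_simps)
  then have "\<omega> (inverse (1 + real m) / 2 / 2) \<le> \<omega> ((1/2) ^ Suc n)"
    by (intro omega_mono) auto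
  then have le: "\<omega> (inverse (1 + real m)) \<le> 4 * \<omega> ((1/2) ^ Suc n)"
    using omega_half[of "inverse (1 + real m)"] omega_half[of "inverse (1 + real m) / 2"] by simp
  define e :: "int \<Rightarrow> int \<Rightarrow> complex" where "e j i = (if i = j then 1 else 0)" for j i
  let ?I = "{-(2 ^ n)..-1::int}"
  have sum_apply: "(\<Sum>j\<in>J. f j) i = (\<Sum>j\<in>J. f j i)" for f :: "int \<Rightarrow> int \<Rightarrow> complex" and J i
    by (induction J rule: infinite_finite_induct) auto
  have comb: "(\<Sum>j\<in>?I. scl l2 (u j) (e j)) i = (if i \<in> ?I then u i else 0)" for u i
    by (simp add: e_def sum_apply if_distrib cong: if_cong)
  have "4 * \<omega> ((1/2) ^ Suc n) \<le> singular_value l2 (op_diff l2 A (flipped A)) m"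
  proof (rule l2.singular_value_ge[of _ ?I m e])
    have "A \<in> bounded_ops l2"
      unfolding A_def by (rule shift.calc_bounded[OF shift.calc_fun_calc[OF lacunary_continuous[OF fin]]])
    then show "op_diff l2 A (flipped A) \<in> bounded_ops l2"
      by (simp add: flipped_def)
    \<comment> \<open>The block has \<open>2 ^ n\<close> columns, and \<open>2 ^ n\<close> is at
      least \<open>m + 1\<close>.\<close>
    show "m < card ?I" using n(1) by (simp add: nat_power_eq)
    show "e j \<in> Space l2" for j
      by (rule l2_supported(1)[of "{j}"]) (auto simp: e_def)
    show "\<forall>j\<in>?I. u j = 0" if "(\<Sum>j\<in>?I. scl l2 (u j) (e j)) = 0" for u
    proof
      fix j assume "j \<in> ?I"
      then show "u j = 0"
        using comb[of u j] unfolding that by simp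
    qed
    show "4 * \<omega> ((1/2) ^ Suc n) * hnorm l2 (\<Sum>j\<in>?I. scl l2 (u j) (e j)) \<le>
        hnorm l2 (op_diff l2 A (flipped A) (\<Sum>j\<in>?I. scl l2 (u j) (e j)))" for u
      unfolding A_def by (rule hankel_block_lower_bound[OF fin]) (use comb in auto)
  qed simp
  with le show ?thesis by linarith
qed

end

theorem theorem3p4:
  fixes \<omega> :: "real \<Rightarrow> real"
  assumes "modulus_of_continuity \<omega>"
    and "finite_valued (omega_sharp \<omega>)"
  shows "\<exists>(H :: (int \<Rightarrow> complex) inner_space) U V h.
    hilbert_space H \<and> unitary H U \<and> unitary H V \<and>
    h \<in> Lambda_space (\<lambda>x. enn2real (omega_sharp \<omega> x)) \<and>
    (\<forall>\<zeta>\<in>sphere 0 1. h \<zeta> \<in> \<real>) \<and>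
    op_rank H (op_diff H U V) = 1 \<and>
    (\<forall>m::nat. singular_value H (op_diff H (fun_calc H h U) (fun_calc H h V)) m
       \<ge> \<omega> (inverse (1 + real m)))"
proof -
  interpret modulus \<omega>
    by unfold_locales (rule assms(1))
  interpret V: unitary_operator l2 "flipped shift" "flipped shift_inv"
    unfolding flipped_def by (rule unitary_operator_conj[OF shift.unitary_operator_axioms flip_unitary])
  have "fun_calc l2 lacunary (flipped shift) = flipped (fun_calc l2 lacunary shift)"
    unfolding flipped_def
    by (rule fun_calc_conj[OF shift.unitary_operator_axioms flip_unitary lacunary_continuous[OF assms(2)]])
  then have "\<forall>m. singular_value l2 (op_diff l2 (fun_calc l2 lacunary shift) (fun_calc l2 lacunary (flipped shift))) m
       \<ge> \<omega> (inverse (1 + real m))"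
    using singular_value_lacunary[OF assms(2)] by simp
  moreover have "\<forall>\<zeta>\<in>sphere 0 1. lacunary \<zeta> \<in> \<real>"
    by (simp add: lacunary_def)
  ultimately show ?thesis
    using hilbert_space_l2 shift.unitary_U V.unitary_U lacunary_Lambda[OF assms(2)] rank_shift_diff
    by blast
qed

end
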